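(* Let $c$, $s$ and $k$ be fixed integers satisfying $c,k\ge 2$ and $1\le s\le c-1$. Let $t=\lceil sk/c\rceil$ and let $\lambda\in[c]$ be the integer with $\lambda\equiv sk \pmod{c}$. Then \[\lim_{n\to\infty} f_{c,s}(n,k)\bigg/\binom{n}{t}=\frac{1}{\binom{k}{t}-m(k,t,\lambda;s+1,c-s+1)}.\]
   Context: For a positive integer $m$, $[m]=\{1,\dots,m\}$, and $\binom{X}{k}$ is the family of $k$-subsets of $X$. A hypergraph $\mathcal{F}\subseteq 2^{[n]}$ is $(c,s)$-frameproof if for every $c+1$ edges $A_0,A_1,\dots,A_c\in\mathcal{F}$ with $A_0\neq A_j$ for each $j\in[c]$ (where $A_1,\dots,A_c$ need not be distinct), there is some $i\in A_0$ with $|\{j\in[c]: i\in A_j\}|<s$. $f_{c,s}(n,k)$ denotes the maximum size of a $(c,s)$-frameproof hypergraph $\mathcal{F}\subseteq\binom{[n]}{k}$. A sequence $A_1,\dots,A_\lambda$ of subsets of $[n]$ (repetitions allowed) is $k_1$-disjoint if $\bigcap_{i\in B}A_i=\emptyset$ for every $B\in\binom{[\lambda]}{k_1}$ (vacuous if $k_1>\lambda$); it is $k_2$-covering if $\bigcup_{i\in B}A_i=[n]$ for every $B\in\binom{[\lambda]}{k_2}$ (vacuous if $k_2>\lambda$); it is $(k_1,k_2)$-disjoint if it is both $k_1$-disjoint and $k_2$-covering. The generalized matching number $m(n,t,\lambda;k_1,k_2)$ is the maximum size of a family $\mathcal{F}\subseteq\binom{[n]}{t}$ such that there are no $A_1,\dots,A_\lambda\in\mathcal{F}$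 (not necessarily distinct) forming a $(k_1,k_2)$-disjoint sequence. *)

theory Defs
  imports Complex_Main "HOL-Library.Ramsey" "HOL-Number_Theory.Cong"
begin

text \<open>
  The family of \<open>k\<close>-subsets of \<open>X\<close> is \<open>nsets X k\<close> (written \<open>[X]\<^bsup>k\<^esup>\<close>) from the Ramsey theory.
  A sequence \<open>A\<^sub>1, \<dots>, A\<^sub>m\<close> is a function on \<open>nat\<close> of which only the values on \<open>{1..m}\<close> matter.
\<close>

definition frameproof :: "nat \<Rightarrow> nat \<Rightarrow> nat set set \<Rightarrow> bool" where
  "frameproof c s F \<longleftrightarrow>
    (\<forall>A0\<in>F. \<forall>A :: nat \<Rightarrow> nat set.
       (\<forall>j\<in>{1..c}. A j \<in> F \<and> A0 \<noteq> A j) \<longrightarrow>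
       (\<exists>i\<in>A0. card {j\<in>{1..c}. i \<in> A j} < s))"

text \<open>
  The maximum ranges over a finite set of numbers; it is nonempty because the empty
  hypergraph is frameproof.
\<close>

definition max_frameproof :: "nat \<Rightarrow> nat \<Rightarrow> nat \<Rightarrow> nat \<Rightarrow> nat" where
  "max_frameproof c s n k = Max {card F | F. F \<subseteq> [{1..n}]\<^bsup>k\<^esup> \<and> frameproof c s F}"

definition disjoint_seq :: "nat \<Rightarrow> nat \<Rightarrow> (nat \<Rightarrow> nat set) \<Rightarrow> bool" where
  "disjoint_seq l k1 A \<longleftrightarrow> (\<forall>B\<in>[{1..l}]\<^bsup>k1\<^esup>. (\<Inter>i\<in>B. A i) = {})"

definition covering_seq :: "nat \<Rightarrow> nat \<Rightarrow> nat \<Rightarrow> (nat \<Rightarrow> nat set) \<Rightarrow> bool" where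
  "covering_seq n l k2 A \<longleftrightarrow> (\<forall>B\<in>[{1..l}]\<^bsup>k2\<^esup>. (\<Union>i\<in>B. A i) = {1..n})"

definition disjoint_covering_seq ::
    "nat \<Rightarrow> nat \<Rightarrow> nat \<Rightarrow> nat \<Rightarrow> (nat \<Rightarrow> nat set) \<Rightarrow> bool" where
  "disjoint_covering_seq n l k1 k2 A \<longleftrightarrow> disjoint_seq l k1 A \<and> covering_seq n l k2 A"

text \<open>
  The generalized matching number. For \<open>l \<ge> 1\<close> the empty family is admissible, so the maximum
  ranges over a finite nonempty set.
\<close>

definition gen_matching_number :: "nat \<Rightarrow> nat \<Rightarrow> nat \<Rightarrow> nat \<Rightarrow> nat \<Rightarrow> nat" where
  "gen_matching_number n t l k1 k2 =
    Max {card F | F. F \<subseteq> [{1..n}]\<^bsup>t\<^esup> \<and>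
      \<not> (\<exists>A. (\<forall>i\<in>{1..l}. A i \<in> F) \<and> disjoint_covering_seq n l k1 k2 A)}"

end

(*
  Upper bound: if the t-subsets of an edge A0 that lie in a further edge contained a
  (s+1, c-s+1)-disjoint sequence of length l, then, as s k = c (t - 1) + l, it could be completed by
  c - l sets of size t - 1 so that every point is covered exactly s times. Unless A0 has an own
  (t-1)-subset (at most C(n, t-1) edges do), frameproofness is violated. So almost every edge has
  at least C(k, t) - m own t-subsets.

  Lower bound: let M be an extremal family for m and H its complement in the t-subsets of [k]. It
  suffices to pack copies of H almost perfectly so that two copies share at most t vertices, and
  no t-set of a copy of H lies inside another copy. The family of all copies of H on N vertices is
  regular, i.e. a perfect fractional packing. Blowing up every vertex by a power of Z_m turns it into
  an integral one: polynomials of degree at most t over Z_m serve as codewords, and linear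
  conditions let each transversal t-set over T decide which of the copies through T uses it.
  Working in Z_m with m = 1 modulo a constant, instead of a prime field, leaves the admissible m
  dense enough to reach every n. Finally N tends to infinity.
*)

theory Submission
  imports Defs "HOL-Computational_Algebra.Polynomial" "HOL-Combinatorics.Permutations"
    "HOL-Real_Asymp.Real_Asymp"
begin

section \<open>Disjoint covering sequences and own subsets\<close>

lemma nsets_finite_iff:
  "finite A \<Longrightarrow> S \<in> [A]\<^bsup>r\<^esup> \<longleftrightarrow> S \<subseteq> A \<and> card S = r"
  by (auto simp: nsets_def finite_subset)

lemma card_le_iff_nsets_empty:
  assumes "finite J"
  shows "card J \<le> p \<longleftrightarrow> [J]\<^bsup>Suc p\<^esup> = {}"
  using assms by (auto simp: nsets_eq_empty_iff)

text \<open>An index set \<open>B\<close> of size \<open>p + 1\<close> has a common point exactly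
  when it fits inside the set of all indices whose sets contain that point.\<close>

lemma disjoint_seq_iff:
  "disjoint_seq l (Suc p) A \<longleftrightarrow> (\<forall>i. card {j\<in>{1..l}. i \<in> A j} \<le> p)"
proof -
  have "disjoint_seq l (Suc p) A \<longleftrightarrow> (\<forall>B\<in>[{1..l}]\<^bsup>Suc p\<^esup>. \<forall>i. \<not> B \<subseteq> {j\<in>{1..l}. i \<in> A j})"
    unfolding disjoint_seq_def
  proof (intro ball_cong refl)
    fix B assume "B \<in> [{1..l}]\<^bsup>Suc p\<^esup>"
    then have "B \<subseteq> {1..l}" by (simp add: nsets_def)
    then show "((\<Inter>i\<in>B. A i) = {}) = (\<forall>i. \<not> B \<subseteq> {j\<in>{1..l}. i \<in> A j})"
      by blast
  qed
  also have "\<dots> \<longleftrightarrow> (\<forall>i. [{j\<in>{1..l}. i \<in> A j}]\<^bsup>Suc p\<^esup> = {})"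
    unfolding nsets_def by blast
  finally show ?thesis
    by (simp add: card_le_iff_nsets_empty)
qed

text \<open>Dual form: a union misses a point exactly when \<open>B\<close> lies among the indices
  whose sets miss it.\<close>

lemma covering_seq_iff:
  assumes "\<forall>j\<in>{1..l}. A j \<subseteq> {1..k}"
  shows "covering_seq k l (Suc q) A \<longleftrightarrow> (\<forall>i\<in>{1..k}. card {j\<in>{1..l}. i \<notin> A j} \<le> q)"
proof -
  have "covering_seq k l (Suc q) A \<longleftrightarrow>
      (\<forall>B\<in>[{1..l}]\<^bsup>Suc q\<^esup>. \<forall>i\<in>{1..k}. \<not> B \<subseteq> {j\<in>{1..l}. i \<notin> A j})"
    unfolding covering_seq_def nsets_def
  proof (intro ball_cong refl)
    fix B assume B: "B \<in> {N. N \<subseteq> {1..l} \<and> finite N \<and> card N = Suc q}"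
    then have "(\<Union>i\<in>B. A i) \<subseteq> {1..k}" using assms by blast
    then have "(\<Union>i\<in>B. A i) = {1..k} \<longleftrightarrow> {1..k} \<subseteq> (\<Union>i\<in>B. A i)" by blast
    then show "((\<Union>i\<in>B. A i) = {1..k}) = (\<forall>i\<in>{1..k}. \<not> B \<subseteq> {j \<in> {1..l}. i \<notin> A j})"
      using B by blast
  qed
  also have "\<dots> \<longleftrightarrow> (\<forall>i\<in>{1..k}. [{j\<in>{1..l}. i \<notin> A j}]\<^bsup>Suc q\<^esup> = {})"
    unfolding nsets_def by blast
  finally show ?thesis
    by (simp add: card_le_iff_nsets_empty)
qed

text \<open>Points are dealt out one at a time so that the sizes of the sets never differ by more
  than one. The lemma is used with constant \<open>e = s\<close> for the positivity of the
  denominator, and with the deficits \<open>s - d x\<close> to complete a sequence.\<close>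

lemma equitable_sets:
  fixes e :: "'a \<Rightarrow> nat"
  assumes "finite X" "\<forall>x\<in>X. e x \<le> r" "l \<le> r" "sum e X = r * q + l"
  shows "\<exists>B. (\<forall>j\<in>{1..r}. B j \<subseteq> X \<and> card (B j) = (if j \<le> l then q + 1 else q))
    \<and> (\<forall>x\<in>X. card {j\<in>{1..r}. x \<in> B j} = e x)"
  using assms
proof (induction X arbitrary: q l rule: finite_induct)
  case empty
  then show ?case by (intro exI[of _ "\<lambda>_. {}"]) auto
next
  case (insert x X)
  have ex: "e x \<le> r" and sm: "e x + sum e X = r * q + l"
    using insert by auto
  \<comment> \<open>\<open>J\<close> is a cyclic interval of length \<open>e x\<close> ending at
    position \<open>l\<close>. The other points are distributed first, with \<open>l'\<close> sets
    of the larger size \<open>q' + 1\<close>; adding \<open>x\<close> on \<open>J\<close> moves the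
    end of the block of larger sets from \<open>l'\<close> to \<open>l\<close> and raises the base
    size to \<open>q\<close> when the interval wraps around.\<close>
  define l' q' J where "l' = (if e x \<le> l then l - e x else r + l - e x)"
    and "q' = (if e x \<le> l then q else q - 1)"
    and "J = (if e x \<le> l then {l - e x<..l} else {1..l} \<union> {r + l - e x<..r})"
  have q: "q > 0" if "\<not> e x \<le> l" using that sm by (cases q) auto
  have "l' \<le> r" using insert.prems ex by (auto simp: l'_def)
  moreover have "sum e X = r * q' + l'"
  proof (cases "e x \<le> l")
    case False
    then obtain q0 where "q = Suc q0" using q by (cases q) auto
    then show ?thesis using sm False ex by (auto simp: l'_def q'_def)
  qed (use sm in \<open>auto simp: l'_def q'_def\<close>)
  moreover have "\<forall>x\<in>X. e x \<le> r" using insert.prems by auto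
  ultimately obtain B where B: "\<forall>j\<in>{1..r}. B j \<subseteq> X \<and> card (B j) = (if j \<le> l' then q' + 1 else q')"
    "\<forall>x\<in>X. card {j\<in>{1..r}. x \<in> B j} = e x"
    using insert.IH[of l' q'] by blast
  have J: "J \<subseteq> {1..r}" "card J = e x"
  proof -
    show "J \<subseteq> {1..r}" using ex insert.prems by (auto simp: J_def)
    have "card ({1..l} \<union> {r + l - e x<..r}) = card {1..l} + card {r + l - e x<..r}" if "\<not> e x \<le> l"
      using ex by (intro card_Un_disjoint) auto
    then show "card J = e x" using ex insert.prems by (auto simp: J_def)
  qed
  define B' where "B' j = (if j \<in> J then insert x (B j) else B j)" for j
  have "B' j \<subseteq> insert x X \<and> card (B' j) = (if j \<le> l then q + 1 else q)" if j: "j \<in> {1..r}" for j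
  proof -
    have sub: "B j \<subseteq> X" and c: "card (B j) = (if j \<le> l' then q' + 1 else q')" using B j by auto
    have "finite (B j)" "x \<notin> B j" using sub insert.hyps finite_subset by auto
    then have "card (B' j) = (if j \<le> l' then q' + 1 else q') + (if j \<in> J then 1 else 0)"
      by (simp add: B'_def c)
    also have "\<dots> = (if j \<le> l then q + 1 else q)"
      using j ex insert.prems q by (auto simp: l'_def q'_def J_def)
    finally show ?thesis using sub by (auto simp: B'_def)
  qed
  moreover have "card {j\<in>{1..r}. y \<in> B' j} = e y" if y: "y \<in> insert x X" for y
  proof (cases "y = x")
    case True
    have "{j\<in>{1..r}. y \<in> B' j} = J"
      using True J B insert.hyps by (auto simp: B'_def)
    then show ?thesis using J True by simp
  next
    case False
    then have "{j\<in>{1..r}. y \<in> B' j} = {j\<in>{1..r}. y \<in> B j}" by (auto simp: B'_def)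
    then show ?thesis using y False B by auto
  qed
  ultimately show ?case by blast
qed

section \<open>Attained maxima, the arithmetic of \<open>t\<close> and \<open>l\<close>, and
  packings\<close>

definition free_family :: "nat \<Rightarrow> nat \<Rightarrow> nat \<Rightarrow> nat \<Rightarrow> nat \<Rightarrow> nat set set \<Rightarrow> bool" where
  "free_family n t l k1 k2 F \<longleftrightarrow> F \<subseteq> [{1..n}]\<^bsup>t\<^esup> \<and>
      \<not> (\<exists>A. (\<forall>i\<in>{1..l}. A i \<in> F) \<and> disjoint_covering_seq n l k1 k2 A)"

lemma gen_matching_number_alt:
  "gen_matching_number n t l k1 k2 = Max (card ` {F. free_family n t l k1 k2 F})"
  unfolding gen_matching_number_def free_family_def by (rule arg_cong[of _ _ Max]) auto

lemma finite_free_family: "finite {F. free_family n t l k1 k2 F}"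
  by (rule finite_subset[of _ "Pow ([{1..n}]\<^bsup>t\<^esup>)"])
    (auto simp: free_family_def finite_imp_finite_nsets)

lemma gen_matching_number_ge:
  "free_family n t l k1 k2 F \<Longrightarrow> card F \<le> gen_matching_number n t l k1 k2"
  unfolding gen_matching_number_alt using finite_free_family by (intro Max_ge) auto

lemma gen_matching_number_attained:
  assumes "l \<ge> 1"
  shows "\<exists>F. free_family n t l k1 k2 F \<and> card F = gen_matching_number n t l k1 k2"
proof -
  have "free_family n t l k1 k2 {}" using assms by (force simp: free_family_def)
  then have "Max (card ` {F. free_family n t l k1 k2 F}) \<in> card ` {F. free_family n t l k1 k2 F}"
    using finite_free_family by (intro Max_in) auto
  then show ?thesis unfolding gen_matching_number_alt by auto
qed

lemma finite_frameproof_sizes: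
  "finite {card F | F. F \<subseteq> [{1..n}]\<^bsup>k\<^esup> \<and> frameproof c s F}"
  by (rule finite_subset[of _ "card ` Pow ([{1..n}]\<^bsup>k\<^esup>)"])
    (auto simp: finite_imp_finite_nsets)

lemma max_frameproof_ge:
  "F \<subseteq> [{1..n}]\<^bsup>k\<^esup> \<Longrightarrow> frameproof c s F \<Longrightarrow> card F \<le> max_frameproof c s n k"
  unfolding max_frameproof_def using finite_frameproof_sizes by (intro Max_ge) blast+

lemma max_frameproof_attained:
  "\<exists>F. F \<subseteq> [{1..n}]\<^bsup>k\<^esup> \<and> frameproof c s F \<and> card F = max_frameproof c s n k"
proof -
  have "frameproof c s {}" by (simp add: frameproof_def)
  then have "max_frameproof c s n k \<in> {card F | F. F \<subseteq> [{1..n}]\<^bsup>k\<^esup> \<and> frameproof c s F}"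
    unfolding max_frameproof_def using finite_frameproof_sizes by (intro Max_in) blast+
  then show ?thesis by auto
qed

text \<open>With the remainder in \<open>{1..c}\<close> instead of \<open>{0..<c}\<close>, the
  ceiling is the quotient plus one even if \<open>c\<close> divides \<open>s * k\<close>.\<close>

lemma ceiling_division_with_remainder:
  assumes "c \<ge> 1" "s * k \<ge> 1" "int t = \<lceil>real (s * k) / real c\<rceil>"
    and "l \<in> {1..c}" and "[l = s * k] (mod c)"
  shows "t \<ge> 1" "s * k = c * (t - 1) + l"
proof -
  \<comment> \<open>Otherwise \<open>1 \<le> s * k < l \<le> c\<close>, while \<open>l mod c\<close>
    is \<open>l\<close> or \<open>0\<close>.\<close>
  have "l \<le> s * k"
  proof (rule ccontr)
    assume "\<not> l \<le> s * k"
    moreover from this have "l mod c = s * k"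
      using assms by (auto simp: unique_euclidean_semiring_class.cong_def)
    ultimately show False using assms by (cases "l = c") auto
  qed
  then have "c dvd s * k - l" using assms(5) mod_eq_dvd_iff_nat[of l "s * k" c] by (simp add: unique_euclidean_semiring_class.cong_def)
  then obtain a where "s * k - l = c * a" by auto
  then have a: "s * k = c * a + l" using \<open>l \<le> s * k\<close> by simp
  have "\<lceil>real (s * k) / real c\<rceil> = int a + 1"
    using assms(1,4) unfolding a by (intro ceiling_unique) (auto simp: field_simps)
  then have "t = a + 1" using assms(3) by linarith
  then show "t \<ge> 1" "s * k = c * (t - 1) + l" using a by auto
qed

text \<open>Induced packings in the style of Frankl and Furedi. Copies are embeddings indexed by an
  arbitrary type, so that codes can serve as indices. A shared t-set that is an edge of neither copy
  is allowed.\<close>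

definition induced_packing ::
    "nat \<Rightarrow> nat \<Rightarrow> nat set set \<Rightarrow> nat \<Rightarrow> 'x set \<Rightarrow> ('x \<Rightarrow> nat \<Rightarrow> nat) \<Rightarrow> bool" where
  "induced_packing k t H n X P \<longleftrightarrow>
    (\<forall>x\<in>X. inj_on (P x) {1..k} \<and> P x ` {1..k} \<subseteq> {1..n}) \<and>
    (\<forall>x\<in>X. \<forall>y\<in>X. x \<noteq> y \<longrightarrow> card (P x ` {1..k} \<inter> P y ` {1..k}) \<le> t \<and>
      (\<forall>S\<in>H. \<not> P x ` S \<subseteq> P y ` {1..k}))"

section \<open>Frameproof hypergraphs through the t-subsets of an edge\<close>

context
  fixes c s k t l :: nat
  assumes s1: "1 \<le> s" and sc: "s < c" and t1: "1 \<le> t" and l: "1 \<le> l" "l \<le> c"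
    and sk: "s * k = c * (t - 1) + l"
begin

text \<open>The covering half bounds the number of sets missing a point by \<open>c - s\<close>;
  hence \<open>c - l\<close> further sets are enough to raise its multiplicity to
  \<open>s\<close>.\<close>

lemma disjoint_covering_seqD:
  assumes "disjoint_covering_seq k l (s + 1) (c - s + 1) A" "\<forall>j\<in>{1..l}. A j \<subseteq> {1..k}" "i \<in> {1..k}"
  shows "card {j\<in>{1..l}. i \<in> A j} \<le> s" "s - card {j\<in>{1..l}. i \<in> A j} \<le> c - l"
proof -
  have 1: "card {j\<in>{1..l}. i \<in> A j} \<le> s" "card {j\<in>{1..l}. i \<notin> A j} \<le> c - s"
    using assms by (auto simp: disjoint_covering_seq_def disjoint_seq_iff covering_seq_iff)
  have "card {j\<in>{1..l}. i \<in> A j} + card {j\<in>{1..l}. i \<notin> A j} = card ({j\<in>{1..l}. i \<in> A j} \<union> {j\<in>{1..l}. i \<notin> A j})"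
    by (intro card_Un_disjoint[symmetric]) auto
  also have "{j\<in>{1..l}. i \<in> A j} \<union> {j\<in>{1..l}. i \<notin> A j} = {1..l}" by auto
  finally show "card {j\<in>{1..l}. i \<in> A j} \<le> s" "s - card {j\<in>{1..l}. i \<in> A j} \<le> c - l"
    using 1 l sc by auto
qed

text \<open>Among all \<open>c\<close> sets a point is contained in \<open>s\<close> and missed by
  \<open>c - s\<close>; choosing \<open>l\<close> of them can only lower both counts.\<close>

lemma disjoint_covering_seqI:
  assumes B: "\<forall>j\<in>{1..c}. B j \<subseteq> {1..k}" "\<forall>i\<in>{1..k}. card {j\<in>{1..c}. i \<in> B j} = s"
    and e: "inj_on e {1..l}" "e ` {1..l} \<subseteq> {1..c}"
  shows "disjoint_covering_seq k l (s + 1) (c - s + 1) (B \<circ> e)"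
proof -
  have sub: "\<forall>j\<in>{1..l}. (B \<circ> e) j \<subseteq> {1..k}" using B e by auto
  have le: "card {j\<in>{1..l}. P (e j)} \<le> card {j\<in>{1..c}. P j}" for P
  proof -
    have "card {j\<in>{1..l}. P (e j)} = card (e ` {j\<in>{1..l}. P (e j)})"
      by (intro card_image[symmetric] inj_on_subset[OF e(1)]) auto
    also have "\<dots> \<le> card {j\<in>{1..c}. P j}" using e(2) by (intro card_mono) (simp, blast)
    finally show ?thesis .
  qed
  have "card {j\<in>{1..l}. i \<in> (B \<circ> e) j} \<le> s" for i
  proof (cases "i \<in> {1..k}")
    case True
    then show ?thesis using le[of "\<lambda>j. i \<in> B j"] B by simp
  next
    case False
    then have "{j\<in>{1..l}. i \<in> (B \<circ> e) j} = {}" using sub by blast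
    then show ?thesis by (simp only: card.empty)
  qed
  moreover have "card {j\<in>{1..l}. i \<notin> (B \<circ> e) j} \<le> c - s" if "i \<in> {1..k}" for i
  proof -
    have "card {j\<in>{1..c}. i \<notin> B j} = card ({1..c} - {j\<in>{1..c}. i \<in> B j})"
      by (rule arg_cong[of _ _ card]) auto
    also have "\<dots> = c - s" using B that by (subst card_Diff_subset) auto
    finally show ?thesis using le[of "\<lambda>j. i \<notin> B j"] by simp
  qed
  ultimately show ?thesis
    using sub by (simp add: disjoint_covering_seq_def disjoint_seq_iff covering_seq_iff)
qed

text \<open>Positivity of the denominator: dealing the \<open>s * k\<close> incidences evenly into
  \<open>c\<close> sets gives \<open>l\<close> sets of size \<open>t\<close> that form a forbidden
  sequence, so the family of all t-subsets is not free.\<close>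

lemma gen_matching_number_less:
  "gen_matching_number k t l (s + 1) (c - s + 1) < k choose t"
proof -
  obtain M where M: "free_family k t l (s + 1) (c - s + 1) M"
    "card M = gen_matching_number k t l (s + 1) (c - s + 1)"
    using gen_matching_number_attained l by blast
  have "\<exists>B. (\<forall>j\<in>{1..c}. B j \<subseteq> {1..k} \<and> card (B j) = (if j \<le> l then t - 1 + 1 else t - 1))
    \<and> (\<forall>x\<in>{1..k}. card {j\<in>{1..c}. x \<in> B j} = s)"
    using sc l sk by (intro equitable_sets) (auto simp: mult.commute)
  then obtain B where B: "\<forall>j\<in>{1..c}. B j \<subseteq> {1..k} \<and> card (B j) = (if j \<le> l then t - 1 + 1 else t - 1)"
    "\<forall>x\<in>{1..k}. card {j\<in>{1..c}. x \<in> B j} = s" by blast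
  have "disjoint_covering_seq k l (s + 1) (c - s + 1) (B \<circ> (\<lambda>j. j))"
    using B l by (intro disjoint_covering_seqI) auto
  moreover have Bt: "\<forall>j\<in>{1..l}. B j \<in> [{1..k}]\<^bsup>t\<^esup>"
    using B l t1 by (auto simp: nsets_finite_iff)
  ultimately have "M \<noteq> [{1..k}]\<^bsup>t\<^esup>" using M(1) by (auto simp: free_family_def o_def)
  then have "M \<subset> [{1..k}]\<^bsup>t\<^esup>" using M(1) by (auto simp: free_family_def)
  then have "card M < card ([{1..k}]\<^bsup>t\<^esup>)" by (intro psubset_card_mono finite_imp_finite_nsets) auto
  then show ?thesis using M(2) by (simp add: card_nsets)
qed

text \<open>
  A packing of copies of \<open>[k]\<^sup>t - M\<close> gives a frameproof family: if the traces of \<open>c\<close> other edges cover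
  every point of \<open>A0\<close> at least \<open>s\<close> times, shrink the traces until every point is covered exactly
  \<open>s\<close> times; then at least \<open>l\<close> traces still have size \<open>t\<close>, so they were not shrunk and lie in \<open>M\<close>.
\<close>

lemma frameproof_of_packing:
  fixes P :: "'x \<Rightarrow> nat \<Rightarrow> nat"
  assumes M: "free_family k t l (s + 1) (c - s + 1) M"
    and inj: "\<And>x. x \<in> X \<Longrightarrow> inj_on (P x) {1..k}"
    and small: "\<And>x y. x \<in> X \<Longrightarrow> y \<in> X \<Longrightarrow> x \<noteq> y \<Longrightarrow> card (P x ` {1..k} \<inter> P y ` {1..k}) \<le> t"
    and own: "\<And>x y S. x \<in> X \<Longrightarrow> y \<in> X \<Longrightarrow> x \<noteq> y \<Longrightarrow> S \<in> [{1..k}]\<^bsup>t\<^esup> - M \<Longrightarrow> \<not> P x ` S \<subseteq> P y ` {1..k}"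
  shows "frameproof c s ((\<lambda>x. P x ` {1..k}) ` X)"
  unfolding frameproof_def
proof (intro ballI allI impI)
  fix A0 and A :: "nat \<Rightarrow> nat set"
  assume "A0 \<in> (\<lambda>x. P x ` {1..k}) ` X"
  then obtain x where x: "x \<in> X" "A0 = P x ` {1..k}" by auto
  assume A: "\<forall>j\<in>{1..c}. A j \<in> (\<lambda>x. P x ` {1..k}) ` X \<and> A0 \<noteq> A j"
  have "\<forall>j\<in>{1..c}. \<exists>y. y \<in> X \<and> A j = P y ` {1..k} \<and> y \<noteq> x" using A x by blast
  then obtain y where y: "\<forall>j\<in>{1..c}. y j \<in> X \<and> A j = P (y j) ` {1..k} \<and> y j \<noteq> x"
    by metis
  show "\<exists>i\<in>A0. card {j \<in> {1..c}. i \<in> A j} < s"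
  proof (rule ccontr)
    assume "\<not> ?thesis"
    then have "\<forall>i\<in>{1..k}. s \<le> card {j\<in>{1..c}. P x i \<in> A j}" using x by force
    then have "\<forall>i\<in>{1..k}. \<exists>J. J \<subseteq> {j\<in>{1..c}. P x i \<in> A j} \<and> card J = s"
      by (meson obtain_subset_with_card_n)
    then obtain J where J: "\<forall>i\<in>{1..k}. J i \<subseteq> {j\<in>{1..c}. P x i \<in> A j} \<and> card (J i) = s"
      by metis
    define B where "B j = {i\<in>{1..k}. j \<in> J i}" for j
    have PB: "P x ` B j \<subseteq> A j" for j
    proof (rule image_subsetI)
      fix i assume "i \<in> B j"
      then have "i \<in> {1..k}" "j \<in> J i" by (auto simp: B_def)
      then show "P x i \<in> A j" using J by blast
    qed
    have cB: "card (B j) \<le> t" if j: "j \<in> {1..c}" for j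
    proof -
      have "card (B j) = card (P x ` B j)"
        by (intro card_image[symmetric] inj_on_subset[OF inj[OF x(1)]]) (auto simp: B_def)
      also have "\<dots> \<le> card (P x ` {1..k} \<inter> P (y j) ` {1..k})"
      proof (rule card_mono)
        have "B j \<subseteq> {1..k}" by (auto simp: B_def)
        moreover have "P x ` B j \<subseteq> P (y j) ` {1..k}" using PB[of j] y j by metis
        ultimately show "P x ` B j \<subseteq> P x ` {1..k} \<inter> P (y j) ` {1..k}" by blast
      qed simp
      also have "\<dots> \<le> t" using small x y j by metis
      finally show ?thesis .
    qed
    have deg: "{j\<in>{1..c}. i \<in> B j} = J i" if "i \<in> {1..k}" for i
      using J[rule_format, OF that] that unfolding B_def by blast
    define L where "L = {j\<in>{1..c}. card (B j) = t}"
    \<comment> \<open>The \<open>s * k\<close> incidences are counted by points and by sets. No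
      \<open>B j\<close> has more than \<open>t\<close> elements, so the excess \<open>l\<close>
      over \<open>c * (t - 1)\<close> requires at least \<open>l\<close> sets of size exactly
      \<open>t\<close>.\<close>
    have "c * (t - 1) + l = (\<Sum>i\<in>{1..k}. card {j\<in>{1..c}. i \<in> B j})"
      using deg J sk by (simp add: mult.commute)
    also have "\<dots> = (\<Sum>j\<in>{1..c}. card {i\<in>{1..k}. i \<in> B j})"
      by (intro sum_multicount_gen) auto
    also have "\<dots> = (\<Sum>j\<in>{1..c}. card (B j))"
      by (intro sum.cong refl arg_cong[of _ _ card]) (auto simp: B_def)
    also have "\<dots> \<le> (\<Sum>j\<in>{1..c}. (t - 1) + (if card (B j) = t then 1 else 0))"
      using cB by (intro sum_mono) force
    also have "\<dots> = c * (t - 1) + card L"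
      by (simp add: sum.distrib L_def sum.If_cases Int_def)
    finally have "l \<le> card L" by simp
    then obtain L' where L': "L' \<subseteq> L" "card L' = l" "finite L'"
      by (meson obtain_subset_with_card_n)
    then obtain e where e: "bij_betw e {1..l} L'" by (metis ex_bij_betw_nat_finite_1)
    have "disjoint_covering_seq k l (s + 1) (c - s + 1) (B \<circ> e)"
    proof (rule disjoint_covering_seqI)
      show "\<forall>j\<in>{1..c}. B j \<subseteq> {1..k}" by (auto simp: B_def)
      show "\<forall>i\<in>{1..k}. card {j\<in>{1..c}. i \<in> B j} = s" using deg J by simp
      show "inj_on e {1..l}" "e ` {1..l} \<subseteq> {1..c}" using e L' by (auto simp: bij_betw_def L_def)
    qed
    moreover have "(B \<circ> e) j \<in> M" if "j \<in> {1..l}" for j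
    proof -
      have "e j \<in> L" using e L' that by (auto simp: bij_betw_def)
      then have ej: "e j \<in> {1..c}" "card (B (e j)) = t" by (auto simp: L_def)
      \<comment> \<open>A t-set outside \<open>M\<close> would be an edge of the copy lying in the
        vertex set of another one, against \<open>own\<close>.\<close>
      have "B (e j) \<in> [{1..k}]\<^bsup>t\<^esup>" using ej by (auto simp: nsets_def B_def)
      moreover have "P x ` B (e j) \<subseteq> P (y (e j)) ` {1..k}" using PB y ej by metis
      moreover have "y (e j) \<in> X" "x \<noteq> y (e j)" using y ej by auto
      ultimately show ?thesis using own[OF x(1)] by (metis DiffI comp_apply)
    qed
    ultimately show False using M unfolding free_family_def by blast
  qed
qed

lemma frameproof_own_subsets:
  assumes F: "frameproof c s F" "A0 \<in> F" "A0 \<in> [{1..n}]\<^bsup>k\<^esup>"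
    and no_small: "\<And>T. T \<in> [A0]\<^bsup>(t - 1)\<^esup> \<Longrightarrow> \<exists>B\<in>F. T \<subseteq> B \<and> B \<noteq> A0"
  shows "(k choose t) \<le> gen_matching_number k t l (s + 1) (c - s + 1)
    + card {T \<in> [A0]\<^bsup>t\<^esup>. \<forall>B\<in>F. T \<subseteq> B \<longrightarrow> B = A0}"
proof -
  define Own where "Own = {T \<in> [A0]\<^bsup>t\<^esup>. \<forall>B\<in>F. T \<subseteq> B \<longrightarrow> B = A0}"
  have A0: "finite A0" "card A0 = k" using F by (auto simp: nsets_def)
  then obtain h where h: "bij_betw h {1..k} A0" by (metis ex_bij_betw_nat_finite_1)
  have hS: "h ` S \<in> [A0]\<^bsup>r\<^esup>" if "S \<in> [{1..k}]\<^bsup>r\<^esup>" for S r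
    using that h by (auto simp: nsets_def bij_betw_def card_image inj_on_subset)
  \<comment> \<open>The t-subsets of \<open>A0\<close> that are not own, pulled back to
    \<open>{1..k}\<close>, where the matching number is defined.\<close>
  define N where "N = {S\<in>[{1..k}]\<^bsup>t\<^esup>. h ` S \<notin> Own}"
  have "free_family k t l (s + 1) (c - s + 1) N"
    unfolding free_family_def
  proof (intro conjI notI)
    show "N \<subseteq> [{1..k}]\<^bsup>t\<^esup>" by (auto simp: N_def)
    assume "\<exists>A. (\<forall>i\<in>{1..l}. A i \<in> N) \<and> disjoint_covering_seq k l (s + 1) (c - s + 1) A"
    then obtain S where S: "\<forall>i\<in>{1..l}. S i \<in> N" "disjoint_covering_seq k l (s + 1) (c - s + 1) S"
      by blast
    have Sk: "\<forall>j\<in>{1..l}. S j \<subseteq> {1..k}" using S by (auto simp: N_def nsets_def)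
    \<comment> \<open>\<open>s - d i\<close> further sets have to contain \<open>i\<close>; these
      deficits add up to exactly \<open>c - l\<close> sets of size \<open>t - 1\<close>.\<close>
    define d where "d i = card {j\<in>{1..l}. i \<in> S j}" for i
    have d: "d i \<le> s" "s - d i \<le> c - l" if "i \<in> {1..k}" for i
      using disjoint_covering_seqD[OF S(2) Sk that] by (auto simp: d_def)
    have "(\<Sum>i\<in>{1..k}. d i) = (\<Sum>j\<in>{1..l}. card {i\<in>{1..k}. i \<in> S j})"
      unfolding d_def by (intro sum_multicount_gen) auto
    also have "\<dots> = (\<Sum>j\<in>{1..l}. t)"
    proof (intro sum.cong refl)
      fix j assume "j \<in> {1..l}"
      then have "S j \<subseteq> {1..k}" "card (S j) = t" using S by (auto simp: N_def nsets_def)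
      then show "card {i\<in>{1..k}. i \<in> S j} = t" by (metis Int_def inf.absorb_iff2)
    qed
    finally have sumd: "(\<Sum>i\<in>{1..k}. d i) = l * t" by simp
    have "(\<Sum>i\<in>{1..k}. s - d i) + (\<Sum>i\<in>{1..k}. d i) = (\<Sum>i\<in>{1..k}. s)"
      using d by (subst sum.distrib[symmetric]) (intro sum.cong refl, auto)
    also have "\<dots> = c * (t - 1) + l" using sk by (simp add: mult.commute)
    finally have "(\<Sum>i\<in>{1..k}. s - d i) + l * t = c * (t - 1) + l" using sumd by simp
    moreover have "c * (t - 1) + l = (c - l) * (t - 1) + l * t"
      using l t1 by (cases t) (auto simp: diff_mult_distrib)
    \<comment> \<open>The summand \<open>0\<close> is the remainder in
      \<open>equitable_sets\<close>: all added sets have size exactly \<open>t - 1\<close>.\<close>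
    ultimately have "(\<Sum>i\<in>{1..k}. s - d i) = (c - l) * (t - 1) + 0" by simp
    then have "\<exists>B. (\<forall>j\<in>{1..c - l}. B j \<subseteq> {1..k} \<and> card (B j) = (if j \<le> 0 then t - 1 + 1 else t - 1))
      \<and> (\<forall>x\<in>{1..k}. card {j\<in>{1..c - l}. x \<in> B j} = s - d x)"
      using d by (intro equitable_sets) auto
    then obtain B where B: "\<forall>j\<in>{1..c - l}. B j \<subseteq> {1..k} \<and> card (B j) = t - 1"
      "\<forall>x\<in>{1..k}. card {j\<in>{1..c - l}. x \<in> B j} = s - d x" by auto
    define C where "C j = (if j \<le> l then S j else B (j - l))" for j
    have "\<exists>A\<in>F. h ` C j \<subseteq> A \<and> A \<noteq> A0" if j: "j \<in> {1..c}" for j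
    proof (cases "j \<le> l")
      case True
      then have "S j \<in> N" using S j by auto
      then have "h ` S j \<in> [A0]\<^bsup>t\<^esup>" "h ` S j \<notin> Own" using hS by (auto simp: N_def)
      then show ?thesis using True by (auto simp: Own_def C_def)
    next
      case False
      then have "j - l \<in> {1..c - l}" using j by auto
      then have "B (j - l) \<in> [{1..k}]\<^bsup>(t - 1)\<^esup>" using B by (simp add: nsets_finite_iff)
      then show ?thesis using no_small[OF hS] False by (auto simp: C_def)
    qed
    then obtain A where A: "\<forall>j\<in>{1..c}. A j \<in> F \<and> h ` C j \<subseteq> A j \<and> A j \<noteq> A0" by metis
    then obtain a where a: "a \<in> A0" "card {j\<in>{1..c}. a \<in> A j} < s"
      using F(1,2) unfolding frameproof_def by metis
    then obtain i where i: "i \<in> {1..k}" "a = h i" using h by (auto simp: bij_betw_def)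
    have "{j\<in>{1..c}. i \<in> C j} = {j\<in>{1..l}. i \<in> S j} \<union> (\<lambda>j. j + l) ` {j\<in>{1..c - l}. i \<in> B j}"
    proof (intro equalityI subsetI)
      fix j assume j: "j \<in> {j\<in>{1..c}. i \<in> C j}"
      show "j \<in> {j\<in>{1..l}. i \<in> S j} \<union> (\<lambda>j. j + l) ` {j\<in>{1..c - l}. i \<in> B j}"
      proof (cases "j \<le> l")
        case False
        then have "j - l \<in> {j\<in>{1..c - l}. i \<in> B j}" "j = (j - l) + l" using j by (auto simp: C_def)
        then show ?thesis by blast
      qed (use j in \<open>auto simp: C_def\<close>)
    qed (use l in \<open>auto simp: C_def\<close>)
    then have "card {j\<in>{1..c}. i \<in> C j} = card {j\<in>{1..l}. i \<in> S j} + card ((\<lambda>j. j + l) ` {j\<in>{1..c - l}. i \<in> B j})"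
      by (simp only:) (intro card_Un_disjoint, auto)
    also have "\<dots> = d i + (s - d i)" using B i by (subst card_image) (auto simp: d_def)
    also have "\<dots> = s" using d i by simp
    finally have "s \<le> card {j\<in>{1..c}. i \<in> C j}" by simp
    also have "\<dots> \<le> card {j\<in>{1..c}. a \<in> A j}" using A i by (intro card_mono) (simp, blast)
    finally show False using a by simp
  qed
  then have "card N \<le> gen_matching_number k t l (s + 1) (c - s + 1)" by (rule gen_matching_number_ge)
  moreover have "card ([{1..k}]\<^bsup>t\<^esup> - N) \<le> card Own"
  proof (rule card_inj_on_le[of "(`) h"])
    show "finite Own" by (auto simp: Own_def A0 finite_imp_finite_nsets)
    show "inj_on ((`) h) ([{1..k}]\<^bsup>t\<^esup> - N)"
      using h by (intro inj_on_subset[OF inj_on_image_Pow[of h "{1..k}"]]) (auto simp: bij_betw_def nsets_def)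
  qed (auto simp: N_def)
  moreover have "card ([{1..k}]\<^bsup>t\<^esup> - N) = (k choose t) - card N"
    by (subst card_Diff_subset) (auto simp: N_def card_nsets finite_imp_finite_nsets)
  ultimately show ?thesis by (simp add: Own_def)
qed

text \<open>An own subset determines its edge. So the edges with an own (t-1)-subset are few, and
  each other edge claims \<open>h\<close> t-subsets for itself.\<close>

lemma card_frameproof_le:
  assumes F: "F \<subseteq> [{1..n}]\<^bsup>k\<^esup>" "frameproof c s F"
    and h: "h + gen_matching_number k t l (s + 1) (c - s + 1) = k choose t"
  shows "card F * h \<le> (n choose t) + (n choose (t - 1)) * h"
proof -
  have finF: "finite F" using F finite_subset finite_imp_finite_nsets by blast
  have sub: "[A]\<^bsup>r\<^esup> \<subseteq> [{1..n}]\<^bsup>r\<^esup>" if "A \<in> F" for A r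
    using F that by (intro nsets_mono) (auto simp: nsets_def)
  define Own where "Own r A = {T \<in> [A]\<^bsup>r\<^esup>. \<forall>B\<in>F. T \<subseteq> B \<longrightarrow> B = A}" for r A
  have Own_sub: "Own r A \<subseteq> [{1..n}]\<^bsup>r\<^esup>" if "A \<in> F" for r A
    using sub[OF that] by (auto simp: Own_def)
  have Own_disj: "A = B" if "A \<in> F" "B \<in> F" "T \<in> Own r A" "T \<in> Own r B" for r A B T
    using that unfolding Own_def nsets_def by blast
  define F1 where "F1 = {A\<in>F. Own (t - 1) A \<noteq> {}}"
  have "\<forall>A\<in>F1. \<exists>T. T \<in> Own (t - 1) A" by (auto simp: F1_def)
  then obtain T where T: "\<forall>A\<in>F1. T A \<in> Own (t - 1) A" by metis
  have F1_sub: "F1 \<subseteq> F" by (auto simp: F1_def)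
  have "card F1 \<le> card ([{1..n}]\<^bsup>(t - 1)\<^esup>)"
  proof (rule card_inj_on_le[of T])
    show "inj_on T F1"
    proof (rule inj_onI)
      fix A B assume "A \<in> F1" "B \<in> F1" "T A = T B"
      then show "A = B" by (metis Own_disj T F1_sub subsetD)
    qed
    show "T ` F1 \<subseteq> [{1..n}]\<^bsup>(t - 1)\<^esup>" using T Own_sub F1_sub by blast
  qed (simp add: finite_imp_finite_nsets)
  then have 1: "card F1 \<le> n choose (t - 1)" by (simp add: card_nsets)
  have "h \<le> card (Own t A)" if A: "A \<in> F - F1" for A
  proof -
    have "(k choose t) \<le> gen_matching_number k t l (s + 1) (c - s + 1) + card (Own t A)"
      unfolding Own_def
    proof (rule frameproof_own_subsets[OF F(2)])
      show "A \<in> F" "A \<in> [{1..n}]\<^bsup>k\<^esup>" using A F(1) by auto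
      show "\<exists>B\<in>F. T \<subseteq> B \<and> B \<noteq> A" if "T \<in> [A]\<^bsup>(t - 1)\<^esup>" for T
        using A that by (auto simp: F1_def Own_def)
    qed
    then show ?thesis using h by simp
  qed
  then have "(\<Sum>A\<in>F - F1. h) \<le> (\<Sum>A\<in>F - F1. card (Own t A))" by (rule sum_mono)
  also have "\<dots> = card (\<Union>A\<in>F - F1. Own t A)"
  proof (rule card_UN_disjoint[symmetric])
    show "\<forall>A\<in>F - F1. finite (Own t A)"
      using finite_subset[OF Own_sub finite_imp_finite_nsets[OF finite_atLeastAtMost]] by simp
    show "\<forall>A\<in>F - F1. \<forall>B\<in>F - F1. A \<noteq> B \<longrightarrow> Own t A \<inter> Own t B = {}"
    proof (intro ballI impI equals0I)
      fix A B T assume "A \<in> F - F1" "B \<in> F - F1" "A \<noteq> B" "T \<in> Own t A \<inter> Own t B"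
      then show False using Own_disj[of A B T t] by simp
    qed
  qed (use finF in simp)
  also have "\<dots> \<le> card ([{1..n}]\<^bsup>t\<^esup>)"
    using Own_sub by (intro card_mono finite_imp_finite_nsets) auto
  finally have 2: "card (F - F1) * h \<le> n choose t" by (simp add: card_nsets)
  have "card F = card F1 + card (F - F1)"
    using finF F1_sub by (metis card_Diff_subset card_mono finite_subset le_add_diff_inverse)
  then have "card F * h = card F1 * h + card (F - F1) * h" by (simp add: add_mult_distrib)
  also have "\<dots> \<le> (n choose (t - 1)) * h + (n choose t)"
    using 1 2 by (intro add_mono mult_right_mono) auto
  finally show ?thesis by simp
qed

lemma card_packing_le_max_frameproof:
  assumes M: "free_family k t l (s + 1) (c - s + 1) M" and "t \<le> k" and ne: "[{1..k}]\<^bsup>t\<^esup> - M \<noteq> {}"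
    and P: "induced_packing k t ([{1..k}]\<^bsup>t\<^esup> - M) n X P"
  shows "card X \<le> max_frameproof c s n k"
proof -
  obtain S where S: "S \<in> [{1..k}]\<^bsup>t\<^esup> - M" using ne by blast
  then have Sk: "S \<subseteq> {1..k}" by (auto simp: nsets_def)
  \<comment> \<open>Equal vertex sets of two copies would put an edge of one copy inside the other;
    such an edge exists because \<open>M\<close> omits some t-subset.\<close>
  have "inj_on (\<lambda>x. P x ` {1..k}) X"
  proof (rule inj_onI)
    fix x y assume xy: "x \<in> X" "y \<in> X" "P x ` {1..k} = P y ` {1..k}"
    then have "P x ` S \<subseteq> P y ` {1..k}" using Sk by blast
    then show "x = y" using P S xy unfolding induced_packing_def by blast
  qed
  then have "card X = card ((\<lambda>x. P x ` {1..k}) ` X)" by (rule card_image[symmetric])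
  also have "\<dots> \<le> max_frameproof c s n k"
  proof (rule max_frameproof_ge)
    show "(\<lambda>x. P x ` {1..k}) ` X \<subseteq> [{1..n}]\<^bsup>k\<^esup>"
      using P by (auto simp: induced_packing_def nsets_finite_iff card_image)
    show "frameproof c s ((\<lambda>x. P x ` {1..k}) ` X)"
      using P unfolding induced_packing_def
      by (intro frameproof_of_packing[OF M]) blast+
  qed
  finally show ?thesis .
qed

end

section \<open>Polynomial codes modulo \<open>m\<close>\<close>

text \<open>\<open>[:m:] dvd d\<close> says that all coefficients vanish modulo \<open>m\<close>.
  This is the root bound over a ring that need not be a field: differences of points are units, so
  linear factors can be divided out one at a time.\<close>

lemma const_dvd_if_dvd_on:
  fixes d :: "int poly" and m :: int
  assumes "finite V" "degree d < card V"
    and "\<And>u v. u \<in> V \<Longrightarrow> v \<in> V \<Longrightarrow> u \<noteq> v \<Longrightarrow> coprime (u - v) m"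
    and "\<And>v. v \<in> V \<Longrightarrow> m dvd poly d v"
  shows "[:m:] dvd d"
  using assms
proof (induction V arbitrary: d rule: finite_induct)
  case (insert v V)
  define q where "q = synthetic_div d v"
  have d: "d = [:- v, 1:] * q + [:poly d v:]"
    unfolding q_def by (rule synthetic_div_correct'[symmetric])
  have "[:m:] dvd q"
  \<comment> \<open>For empty \<open>V\<close> the bound \<open>degree q < card V\<close> fails, but
    then \<open>d\<close> is constant and the quotient is zero.\<close>
  proof (cases "V = {}")
    case True
    then have "degree d = 0" using insert.prems by simp
    then have "q = 0" by (simp add: q_def synthetic_div_eq_0_iff)
    then show ?thesis by simp
  next
    case False
    show ?thesis
    proof (rule insert.IH)
      show "degree q < card V"
      proof -
        have "0 < card V" using insert.hyps False by (simp add: card_gt_0_iff)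
        moreover have "degree d < Suc (card V)" using insert.prems(1) insert.hyps by simp
        ultimately show ?thesis by (simp add: q_def degree_synthetic_div)
      qed
      show "m dvd poly q u" if u: "u \<in> V" for u
      proof -
        have "poly d u = (u - v) * poly q u + poly d v"
          by (subst d) (simp add: algebra_simps)
        then have "(u - v) * poly q u = poly d u - poly d v" by simp
        also have "m dvd \<dots>" using insert.prems(3) u by (intro dvd_diff) auto
        finally have "m dvd (u - v) * poly q u" .
        moreover have "coprime (u - v) m" using insert u by auto
        ultimately show ?thesis by (simp add: coprime_commute coprime_dvd_mult_right_iff)
      qed
    qed (use insert.prems in auto)
  qed
  moreover have "[:m:] dvd [:poly d v:]" using insert.prems(3) by simp
  ultimately show ?case by (subst d) (intro dvd_add dvd_mult)
qed simp

definition root_poly :: "nat set \<Rightarrow> int poly" where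
  "root_poly S = (\<Prod>v\<in>S. [:- int v, 1:])"

lemma degree_root_poly: "degree (root_poly S) = card S"
  unfolding root_poly_def by (subst degree_prod_eq_sum_degree) auto

lemma coeff_root_poly: "coeff (root_poly S) (card S) = 1"
  using lead_coeff_prod[of "\<lambda>v. [:- int v, 1:]" S]
  by (simp add: degree_root_poly[symmetric] root_poly_def)

lemma poly_root_poly: "poly (root_poly S) x = (\<Prod>v\<in>S. x - int v)"
  by (simp add: root_poly_def poly_prod)

lemma poly_root_poly_eq_0_iff: "finite S \<Longrightarrow> poly (root_poly S) (int v) = 0 \<longleftrightarrow> v \<in> S"
  by (simp add: poly_root_poly)

text \<open>Subtracting the right multiple of the monic \<open>root_poly T\<close> removes the
  coefficient at \<open>t\<close>, leaving degree below \<open>t\<close> but \<open>t\<close> roots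
  modulo \<open>m\<close>.\<close>

lemma const_dvd_diff_root_poly:
  fixes d :: "int poly" and m :: int
  assumes T: "finite T" "card T = t" "0 < t" and d: "degree d \<le> t"
    and cop: "\<And>u v. u \<in> T \<Longrightarrow> v \<in> T \<Longrightarrow> u \<noteq> v \<Longrightarrow> coprime (int u - int v) m"
    and dvd: "\<And>v. v \<in> T \<Longrightarrow> m dvd poly d (int v)"
  shows "[:m:] dvd d - smult (coeff d t) (root_poly T)"
proof (rule const_dvd_if_dvd_on[of "int ` T"])
  let ?r = "d - smult (coeff d t) (root_poly T)"
  have "degree ?r \<le> t"
    using d T by (intro degree_diff_le) (auto simp: degree_root_poly intro: order.trans[OF degree_smult_le])
  moreover have "coeff ?r t = 0" using T coeff_root_poly[of T] by simp
  ultimately have "degree ?r < t \<or> ?r = 0"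
    using T by (metis le_neq_implies_less leading_coeff_0_iff)
  then show "degree ?r < card (int ` T)" using T by (auto simp: card_image)
  show "m dvd poly ?r v" if v: "v \<in> int ` T" for v
  proof -
    obtain u where u: "u \<in> T" "v = int u" using v by auto
    then have "poly (root_poly T) v = 0" using T by (simp add: poly_root_poly_eq_0_iff)
    then show ?thesis using dvd u by simp
  qed
qed (use T cop in auto)

text \<open>Coordinates for polynomials of degree at most \<open>t\<close>, when
  \<open>card S = t > 0\<close>: \<open>a\<close> is the leading coefficient, \<open>b\<close> the
  value at \<open>z\<close> of the remainder modulo \<open>root_poly S\<close>, and \<open>w\<close>
  holds the \<open>t - 1\<close> coefficients left. Its index starts at \<open>1\<close> because
  slot \<open>0\<close> of a weight is spent on \<open>a\<close> or \<open>b\<close>.\<close>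

definition codeword :: "nat \<Rightarrow> int \<Rightarrow> nat set \<Rightarrow> int \<Rightarrow> int \<Rightarrow> (nat \<Rightarrow> int) \<Rightarrow> int poly" where
  "codeword t z S a b w = smult a (root_poly S) + [:b:] + [:- z, 1:] * (\<Sum>i\<in>{1..<t}. monom (w i) (i - 1))"

lemma codeword_diff:
  "codeword t z S a b w - codeword t z S a' b' w' = codeword t z S (a - a') (b - b') (\<lambda>i. w i - w' i)"
proof -
  have "(\<Sum>i\<in>{1..<t}. monom (w i - w' i) (i - 1)) =
    (\<Sum>i\<in>{1..<t}. monom (w i) (i - 1)) - (\<Sum>i\<in>{1..<t}. monom (w' i) (i - 1))"
    by (simp add: sum_subtractf[symmetric] diff_monom)
  moreover have "[:b - b':] = [:b:] - [:b':]" by simp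
  ultimately show ?thesis
    unfolding codeword_def by (simp only: smult_diff_left right_diff_distrib)
qed

lemma poly_codeword_at: "poly (codeword t z S a b w) z = a * poly (root_poly S) z + b"
  by (simp add: codeword_def)

lemma degree_codeword_tail:
  assumes "0 < t"
  shows "degree ([:b:] + [:- z, 1:] * (\<Sum>i\<in>{1..<t}. monom (w i) (i - 1))) < t"
proof (cases "(\<Sum>i\<in>{1..<t}. monom (w i) (i - 1)) = 0")
  case False
  then have "t > 1" by (cases "t \<le> 1") auto
  have "degree (\<Sum>i\<in>{1..<t}. monom (w i) (i - 1)) \<le> t - 2"
    by (intro degree_sum_le) (auto intro: order.trans[OF degree_monom_le])
  then have "degree ([:- z, 1:] * (\<Sum>i\<in>{1..<t}. monom (w i) (i - 1))) \<le> 1 + (t - 2)"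
    by (intro order.trans[OF degree_mult_le]) auto
  then show ?thesis using \<open>t > 1\<close> by (intro degree_add_less) auto
qed (use assms in auto)

lemma
  assumes "0 < t" "card S = t"
  shows degree_codeword: "degree (codeword t z S a b w) \<le> t"
    and coeff_codeword: "coeff (codeword t z S a b w) t = a"
proof -
  note tail = degree_codeword_tail[OF assms(1), of b z w]
  then obtain r where r: "codeword t z S a b w = smult a (root_poly S) + r" "degree r < t"
    unfolding codeword_def add.assoc by blast
  show "degree (codeword t z S a b w) \<le> t"
    unfolding r(1) using r(2) assms
    by (intro degree_add_le) (auto simp: degree_root_poly intro: order.trans[OF degree_smult_le])
  have "coeff (root_poly S) t = 1" using coeff_root_poly[of S] assms by simp
  then show "coeff (codeword t z S a b w) t = a"
    unfolding r(1) using coeff_eq_0[OF r(2)] by simp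
qed

lemma const_dvd_imp_dvd_poly:
  fixes m :: int
  shows "[:m:] dvd p \<Longrightarrow> m dvd poly p x"
  by (auto elim!: dvdE)

text \<open>A monic factor is no zero divisor modulo any \<open>m\<close>: divisibility of the
  coefficients of \<open>q\<close> descends from beyond its degree.\<close>

lemma const_dvd_linear_mult:
  fixes m z :: int
  assumes "[:m:] dvd [:- z, 1:] * q"
  shows "[:m:] dvd q"
proof -
  have rec: "m dvd coeff q i - z * coeff q (Suc i)" for i
  proof -
    have "m dvd coeff ([:- z, 1:] * q) (Suc i)" using assms by (simp only: const_poly_dvd_iff)
    then show ?thesis by (simp add: algebra_simps)
  qed
  have "m dvd coeff q i" if "degree q < i + n" for i n
    using that
  proof (induction n arbitrary: i)
    case 0
    then show ?case by (simp add: coeff_eq_0)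
  next
    case (Suc n)
    then have "m dvd coeff q (Suc i)" by simp
    then have "m dvd (coeff q i - z * coeff q (Suc i)) + z * coeff q (Suc i)"
      using rec by (intro dvd_add dvd_mult) auto
    then show ?case by simp
  qed
  then have "m dvd coeff q i" for i by (metis add.commute less_add_Suc1 add_Suc_right)
  then show ?thesis by (simp add: const_poly_dvd_iff)
qed

text \<open>The coordinates can be read off modulo \<open>m\<close>: \<open>a\<close> as the top
  coefficient, \<open>b\<close> from the value at \<open>z\<close>, and \<open>w\<close> after
  cancelling the linear factor. The lemma is applied to differences of codewords.\<close>

lemma const_dvd_codeword:
  assumes "0 < t" "card S = t" "[:m:] dvd codeword t z S a b w"
  shows "m dvd a" "m dvd b" "\<And>i. i \<in> {1..<t} \<Longrightarrow> m dvd w i"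
proof -
  show a: "m dvd a" using assms coeff_codeword[OF assms(1,2)] by (metis const_poly_dvd_iff)
  have "m dvd poly (codeword t z S a b w) z" using assms(3) by (rule const_dvd_imp_dvd_poly)
  then show b: "m dvd b" using a by (simp add: poly_codeword_at dvd_add_right_iff)
  define q where "q = (\<Sum>i\<in>{1..<t}. monom (w i) (i - 1))"
  have "[:- z, 1:] * q = codeword t z S a b w - smult a (root_poly S) - [:b:]"
    by (simp add: codeword_def q_def)
  moreover have "[:m:] dvd smult a (root_poly S)" using a by (simp add: const_poly_dvd_iff)
  moreover have "[:m:] dvd [:b:]" using b by simp
  ultimately have "[:m:] dvd [:- z, 1:] * q" using assms by (metis dvd_diff)
  then have q: "[:m:] dvd q" by (rule const_dvd_linear_mult)
  show "m dvd w i" if i: "i \<in> {1..<t}" for i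
  proof -
    have "coeff q (i - 1) = (\<Sum>j\<in>{1..<t}. if j = i then w j else 0)"
      unfolding q_def coeff_sum coeff_monom using i by (intro sum.cong) auto
    also have "\<dots> = w i" using i by simp
    finally show ?thesis using q by (metis const_poly_dvd_iff)
  qed
qed

text \<open>Vanishing on \<open>T\<close> makes the codeword congruent to \<open>a\<close> times
  \<open>root_poly T\<close>. Evaluation at \<open>z\<close> then leaves one relation between
  \<open>a\<close> and \<open>b\<close>: for \<open>S = T\<close> it kills \<open>b\<close>, and if
  \<open>z\<close> separates the two root polynomials modulo \<open>m\<close>, then \<open>b\<close>
  determines \<open>a\<close>.\<close>

lemma codeword_vanishing_on:
  assumes "0 < t" and S: "card S = t" and T: "finite T" "card T = t"
    and cop: "\<And>u v. u \<in> T \<Longrightarrow> v \<in> T \<Longrightarrow> u \<noteq> v \<Longrightarrow> coprime (int u - int v) m"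
    and dvd: "\<And>v. v \<in> T \<Longrightarrow> m dvd poly (codeword t z S a b w) (int v)"
  shows "S = T \<Longrightarrow> m dvd b"
    and "m dvd a \<Longrightarrow> [:m:] dvd codeword t z S a b w"
    and "coprime (poly (root_poly S) z - poly (root_poly T) z) m \<Longrightarrow> m dvd b \<Longrightarrow>
      [:m:] dvd codeword t z S a b w"
proof -
  let ?f = "codeword t z S a b w"
  have r: "[:m:] dvd ?f - smult a (root_poly T)"
    using const_dvd_diff_root_poly[OF T assms(1) degree_codeword[OF assms(1) S] cop dvd]
      coeff_codeword[OF assms(1) S] by metis
  then have "m dvd poly (?f - smult a (root_poly T)) z" by (rule const_dvd_imp_dvd_poly)
  then have ev: "m dvd a * (poly (root_poly S) z - poly (root_poly T) z) + b"
    by (simp add: poly_codeword_at algebra_simps)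
  show "m dvd b" if "S = T" using ev that by simp
  show *: "[:m:] dvd ?f" if "m dvd a"
  proof -
    have "[:m:] dvd smult a (root_poly T)" using that by (simp add: const_poly_dvd_iff)
    then have "[:m:] dvd (?f - smult a (root_poly T)) + smult a (root_poly T)" using r by (intro dvd_add)
    then show ?thesis by simp
  qed
  show "[:m:] dvd ?f" if "coprime (poly (root_poly S) z - poly (root_poly T) z) m" "m dvd b"
  proof (rule *)
    have "m dvd a * (poly (root_poly S) z - poly (root_poly T) z)"
      using ev that by (simp add: dvd_add_left_iff)
    then show "m dvd a" using that(1) by (simp add: coprime_commute coprime_dvd_mult_left_iff)
  qed
qed

section \<open>The coded blow-up and its copies of \<open>H\<close>\<close>

type_synonym copy_code = "(nat \<Rightarrow> nat) \<times> nat \<times> (nat set \<times> nat \<Rightarrow> nat)"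

text \<open>
  The blow-up has vertices \<open>(v, y)\<close> with \<open>v \<in> {1..N}\<close> and \<open>y\<close> a vector of residues modulo \<open>m\<close> indexed
  by the \<open>t\<close>-subsets \<open>S\<close> of \<open>{0..N}\<close>; the copy coded by \<open>x = (\<sigma>, j, w)\<close> lies over \<open>\<sigma> ` {1..k}\<close>,
  with coordinate \<open>S\<close> given by a polynomial \<open>cw x S\<close> of degree at most \<open>t\<close>. The residue at \<open>z\<close> of this
  polynomial modulo \<open>root_poly S\<close>, called \<open>rem\<close>, depends only on its values on \<open>S\<close>. For \<open>S\<close> in
  the copy of \<open>H\<close> it is the nonzero label \<open>\<beta> S\<close> naming \<open>(\<sigma>, j)\<close>, and it is \<open>0\<close> for the other \<open>S\<close>
  inside \<open>\<sigma> ` {1..k}\<close>: so no \<open>t\<close>-set can play both roles, and a \<open>t\<close>-set of the copy of \<open>H\<close>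
  determines \<open>(\<sigma>, j)\<close>. The leading coefficient is free over the copy of \<open>H\<close>, except that
  \<open>weights\<close> forces their sum to vanish; for \<open>S\<close> not inside \<open>\<sigma> ` {1..k}\<close> it names \<open>\<sigma>\<close>.
  The point \<open>0\<close> is used by no copy and only supplies such an \<open>S\<close> common to all \<open>\<sigma>\<close>.
\<close>

locale coded_packing =
  fixes N k t m \<mu> :: nat and z :: int and H :: "nat set set"
    and idn :: "(nat \<Rightarrow> nat) \<Rightarrow> nat" and \<beta> :: "nat set \<Rightarrow> (nat \<Rightarrow> nat) \<times> nat \<Rightarrow> nat"
  assumes t: "0 < t" and kN: "k \<le> N" "t \<le> N" and m: "0 < m"
    and H: "H \<subseteq> [{1..k}]\<^bsup>t\<^esup>" "H \<noteq> {}"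
    and coprime_points: "\<And>u v. u \<le> N \<Longrightarrow> v \<le> N \<Longrightarrow> u \<noteq> v \<Longrightarrow> coprime (int u - int v) (int m)"
    and coprime_roots: "\<And>S T. S \<in> [{0..N}]\<^bsup>t\<^esup> \<Longrightarrow> T \<in> [{0..N}]\<^bsup>t\<^esup> \<Longrightarrow> S \<noteq> T \<Longrightarrow>
      coprime (poly (root_poly S) z - poly (root_poly T) z) (int m)"
    and idn: "inj_on idn {\<sigma>. \<sigma> permutes {1..N}}" "\<And>\<sigma>. \<sigma> permutes {1..N} \<Longrightarrow> idn \<sigma> < m"
    and \<beta>: "\<And>S. S \<in> [{0..N}]\<^bsup>t\<^esup> \<Longrightarrow> inj_on (\<beta> S) ({\<sigma>. \<sigma> permutes {1..N} \<and> S \<in> (`) \<sigma> ` H} \<times> {..<\<mu>})"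
      "\<And>S \<sigma> j. S \<in> [{0..N}]\<^bsup>t\<^esup> \<Longrightarrow> \<sigma> permutes {1..N} \<Longrightarrow> S \<in> (`) \<sigma> ` H \<Longrightarrow> j < \<mu> \<Longrightarrow>
        \<beta> S (\<sigma>, j) \<in> {1..<m}"
begin

definition I :: "nat set set" where "I = [{0..N}]\<^bsup>t\<^esup>"

definition weights :: "(nat \<Rightarrow> nat) \<Rightarrow> (nat set \<times> nat \<Rightarrow> nat) set" where
  "weights \<sigma> = {w \<in> (I \<times> {..<t}) \<rightarrow>\<^sub>E {..<m}. m dvd (\<Sum>S\<in>(`) \<sigma> ` H. w (S, 0))}"

definition X :: "copy_code set" where
  "X = (SIGMA \<sigma>:{\<sigma>. \<sigma> permutes {1..N}}. {..<\<mu>} \<times> weights \<sigma>)"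

fun lead where
  "lead (\<sigma>, j, w) S = (if S \<subseteq> \<sigma> ` {1..k} then w (S, 0) else idn \<sigma>)"

fun rem where
  "rem (\<sigma>, j, w) S = (if S \<subseteq> \<sigma> ` {1..k} then if S \<in> (`) \<sigma> ` H then \<beta> S (\<sigma>, j) else 0 else w (S, 0 :: nat))"

definition cw :: "copy_code \<Rightarrow> nat set \<Rightarrow> int poly" where
  "cw x S = codeword t z S (int (lead x S)) (int (rem x S)) (\<lambda>i. int (snd (snd x) (S, i)))"

definition point :: "copy_code \<Rightarrow> nat \<Rightarrow> nat \<times> (nat set \<Rightarrow> int)" where
  "point x i = (fst x i, \<lambda>S\<in>I. poly (cw x S) (int (fst x i)) mod int m)"

lemma finite_I: "finite I" by (simp add: I_def finite_imp_finite_nsets)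

lemma in_I: "S \<in> I \<Longrightarrow> finite S" "S \<in> I \<Longrightarrow> card S = t" "S \<in> I \<Longrightarrow> v \<in> S \<Longrightarrow> v \<le> N"
  by (auto simp: I_def nsets_def)

lemma copy_in_I:
  assumes "\<sigma> permutes {1..N}" "S \<in> (`) \<sigma> ` H"
  shows "S \<in> I" "S \<subseteq> \<sigma> ` {1..k}" "S \<subseteq> {1..N}"
proof -
  obtain T where T: "T \<in> H" "S = \<sigma> ` T" using assms by auto
  then have T': "T \<subseteq> {1..k}" "card T = t" "finite T" using H by (auto simp: nsets_def)
  have im: "\<sigma> ` {1..N} = {1..N}" using assms permutes_image by blast
  show "S \<subseteq> \<sigma> ` {1..k}" using T T' by auto
  have "T \<subseteq> {1..N}" using T' kN by force
  then show S: "S \<subseteq> {1..N}" using T im by blast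
  then have "S \<subseteq> {0..N}" by (rule order.trans) auto
  moreover have "card S = t"
    using T T' permutes_inj[OF assms(1)] by (metis card_image inj_on_subset subset_UNIV)
  ultimately show "S \<in> I" by (simp add: I_def nsets_finite_iff)
qed

lemma eq_if_dvd_diff: "u < m \<Longrightarrow> v < m \<Longrightarrow> int m dvd int u - int v \<Longrightarrow> u = v"
  by (metis mod_eq_dvd_iff mod_less of_nat_eq_iff zmod_int)

lemma weights_lt: "w \<in> weights \<sigma> \<Longrightarrow> S \<in> I \<Longrightarrow> i < t \<Longrightarrow> w (S, i) < m"
  by (auto simp: weights_def PiE_iff)

lemma lead_lt: "x \<in> X \<Longrightarrow> S \<in> I \<Longrightarrow> lead x S < m"
  using t idn(2) by (auto simp: X_def weights_lt)

lemma rem_lt: "x \<in> X \<Longrightarrow> S \<in> I \<Longrightarrow> rem x S < m"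
  using t m \<beta>(2) by (auto simp: X_def weights_lt I_def)

lemma cw_diff:
  "cw x S - cw y S = codeword t z S (int (lead x S) - int (lead y S)) (int (rem x S) - int (rem y S))
    (\<lambda>i. int (snd (snd x) (S, i)) - int (snd (snd y) (S, i)))"
  by (simp add: cw_def codeword_diff)

lemma cw_congD:
  assumes "x \<in> X" "y \<in> X" "S \<in> I" "[:int m:] dvd cw x S - cw y S"
  shows "lead x S = lead y S" "rem x S = rem y S"
    "i \<in> {1..<t} \<Longrightarrow> snd (snd x) (S, i) = snd (snd y) (S, i)"
proof -
  note * = const_dvd_codeword[OF t in_I(2)[OF assms(3)] assms(4)[unfolded cw_diff]]
  show "lead x S = lead y S"
    by (rule eq_if_dvd_diff[OF lead_lt[OF assms(1,3)] lead_lt[OF assms(2,3)] *(1)])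
  show "rem x S = rem y S"
    by (rule eq_if_dvd_diff[OF rem_lt[OF assms(1,3)] rem_lt[OF assms(2,3)] *(2)])
  show "snd (snd x) (S, i) = snd (snd y) (S, i)" if "i \<in> {1..<t}"
    using *(3)[OF that] assms that by (intro eq_if_dvd_diff) (auto simp: X_def weights_lt)
qed

text \<open>Slot \<open>0\<close> of the weight sits in \<open>lead\<close> or in
  \<open>rem\<close>, depending on \<open>S\<close> and \<sigma> only; with a common \<sigma> both
  codes use the same place.\<close>

lemma eq_if_cw_cong:
  assumes x: "(\<sigma>, j, w) \<in> X" and y: "(\<sigma>, j, w') \<in> X" and "S \<in> I"
    and dvd: "[:int m:] dvd cw (\<sigma>, j, w) S - cw (\<sigma>, j, w') S"
    and "i < t"
  shows "w (S, i) = w' (S, i)"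
proof (cases "i = 0")
  case True
  then show ?thesis using cw_congD(1,2)[OF x y assms(3) dvd] by (simp split: if_splits)
next
  case False
  then show ?thesis using cw_congD(3)[OF x y assms(3) dvd, of i] assms(5) by simp
qed

text \<open>More than \<open>t\<close> common points determine every coordinate polynomial modulo
  \<open>m\<close>; then \<sigma>, \<open>j\<close> and \<open>w\<close> are read off in this
  order.\<close>

lemma eq_if_agree_Suc:
  assumes x: "x \<in> X" and y: "y \<in> X" and T: "T \<subseteq> {1..N}" "t < card T"
    and agree: "\<And>v S. v \<in> T \<Longrightarrow> S \<in> I \<Longrightarrow> int m dvd poly (cw x S - cw y S) (int v)"
  shows "x = y"
proof -
  obtain \<sigma> j w where x': "x = (\<sigma>, j, w)" by (cases x)
  obtain \<sigma>' j' w' where y': "y = (\<sigma>', j', w')" by (cases y)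
  have per: "\<sigma> permutes {1..N}" "\<sigma>' permutes {1..N}" and j: "j < \<mu>" "j' < \<mu>"
    and w: "w \<in> weights \<sigma>" "w' \<in> weights \<sigma>'"
    using x y by (auto simp: X_def x' y')
  have finT: "finite T" using T finite_subset by blast
  have dvd: "[:int m:] dvd cw x S - cw y S" if S: "S \<in> I" for S
  proof (rule const_dvd_if_dvd_on[of "int ` T"])
    have "degree (cw x S - cw y S) \<le> t"
      unfolding cw_diff using t in_I[OF S] by (intro degree_codeword)
    then show "degree (cw x S - cw y S) < card (int ` T)" using T by (simp add: card_image)
    show "coprime (u - v) (int m)" if "u \<in> int ` T" "v \<in> int ` T" "u \<noteq> v" for u v
      using that T coprime_points by (auto simp: subset_iff)
    show "int m dvd poly (cw x S - cw y S) v" if "v \<in> int ` T" for v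
      using that agree S by blast
  qed (use finT in simp)
  note D = cw_congD[OF x y _ dvd]
  \<comment> \<open>Containing \<open>0\<close>, this set lies inside no copy, so its leading
    coefficient names \<sigma>.\<close>
  have S0: "{0..<t} \<in> I" using kN by (auto simp: I_def nsets_def)
  have "\<not> {0..<t} \<subseteq> \<sigma> ` {1..k}" if "\<sigma> permutes {1..N}" for \<sigma>
  proof -
    have "\<sigma> ` {1..k} \<subseteq> {1..N}" using kN permutes_image[OF that] by force
    then show ?thesis using t by force
  qed
  then have "idn \<sigma> = idn \<sigma>'" using D(1)[OF S0 S0] per by (simp add: x' y')
  then have \<sigma>: "\<sigma>' = \<sigma>" using idn per by (auto simp: inj_on_def)
  obtain S1 where S1: "S1 \<in> (`) \<sigma> ` H" using H by auto
  have "\<beta> S1 (\<sigma>, j) = \<beta> S1 (\<sigma>, j')"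
    using D(2)[OF copy_in_I(1)[OF per(1) S1] copy_in_I(1)[OF per(1) S1]] copy_in_I(2)[OF per(1) S1] S1
    by (simp add: x' y' \<sigma>)
  moreover have "inj_on (\<beta> S1) ({\<sigma>. \<sigma> permutes {1..N} \<and> S1 \<in> (`) \<sigma> ` H} \<times> {..<\<mu>})"
    using \<beta>(1) copy_in_I(1)[OF per(1) S1] by (simp add: I_def)
  ultimately have jj: "j' = j" using j S1 per by (auto dest!: inj_onD)
  have "w = w'"
  proof (rule PiE_ext)
    show "w \<in> (I \<times> {..<t}) \<rightarrow>\<^sub>E {..<m}" "w' \<in> (I \<times> {..<t}) \<rightarrow>\<^sub>E {..<m}"
      using w by (auto simp: weights_def)
    show "w p = w' p" if "p \<in> I \<times> {..<t}" for p
      using eq_if_cw_cong[of \<sigma> j w w' "fst p" "snd p"] x y dvd that by (auto simp: x' y' \<sigma> jj)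
  qed
  then show ?thesis by (simp add: x' y' \<sigma> jj)
qed

text \<open>
  The condition on the sum in \<open>weights\<close> serves for the coordinate \<open>S = T\<close>, the only one that the values
  on \<open>T\<close> leave undetermined.
\<close>

lemma eq_if_agree_on_copy:
  assumes x: "(\<sigma>, j, w) \<in> X" and y: "(\<sigma>', j', w') \<in> X"
    and T: "T \<in> (`) \<sigma> ` H" "T \<subseteq> \<sigma>' ` {1..k}"
    and agree: "\<And>v S. v \<in> T \<Longrightarrow> S \<in> I \<Longrightarrow> int m dvd poly (cw (\<sigma>, j, w) S - cw (\<sigma>', j', w') S) (int v)"
  shows "(\<sigma>, j, w) = (\<sigma>', j', w')"
proof -
  let ?x = "(\<sigma>, j, w)" and ?y = "(\<sigma>', j', w')"
  have per: "\<sigma> permutes {1..N}" "\<sigma>' permutes {1..N}" and j: "j < \<mu>" "j' < \<mu>"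
    and w: "w \<in> weights \<sigma>" "w' \<in> weights \<sigma>'"
    using x y by (auto simp: X_def)
  note TI = copy_in_I[OF per(1) T(1)]
  note van = codeword_vanishing_on[OF t _ in_I(1,2)[OF TI(1)] coprime_points agree[unfolded cw_diff]]
  \<comment> \<open>On the coordinate \<open>S = T\<close> the values on \<open>T\<close> determine
    the remainder.\<close>
  have "int m dvd int (rem ?x T) - int (rem ?y T)"
    by (rule van(1)) (use TI in_I in auto)
  then have "rem ?x T = rem ?y T"
    using x y TI by (intro eq_if_dvd_diff rem_lt) auto
  \<comment> \<open>As \<open>T\<close> also lies inside the second copy, a nonzero remainder there
    is possible only if \<open>T\<close> is an edge of that copy.\<close>
  moreover have "\<beta> T (\<sigma>, j) \<noteq> 0" using \<beta>(2) TI per j T by (fastforce simp: I_def)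
  ultimately have T': "T \<in> (`) \<sigma>' ` H" and "\<beta> T (\<sigma>, j) = \<beta> T (\<sigma>', j')"
    using TI T by (auto split: if_splits)
  moreover have "inj_on (\<beta> T) ({\<sigma>. \<sigma> permutes {1..N} \<and> T \<in> (`) \<sigma> ` H} \<times> {..<\<mu>})"
    using \<beta>(1) TI(1) by (simp add: I_def)
  ultimately have "(\<sigma>, j) = (\<sigma>', j')" using j T per by (auto dest!: inj_onD)
  then have eq: "\<sigma>' = \<sigma>" "j' = j" by auto
  \<comment> \<open>With \<sigma> and \<open>j\<close> shared, the remainders agree for
    \<open>S\<close> inside the copy and the leading coefficients agree for all other
    \<open>S\<close>; either is enough for congruence.\<close>
  have dvd: "[:int m:] dvd cw ?x S - cw ?y S" if S: "S \<in> I" "S \<noteq> T" for S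
  proof (cases "S \<subseteq> \<sigma> ` {1..k}")
    case True
    then have "rem ?x S = rem ?y S" by (simp add: eq)
    then show ?thesis unfolding cw_diff
      by (intro van(3)) (use S TI in_I coprime_roots in \<open>auto simp: I_def\<close>)
  next
    case False
    then have "lead ?x S = lead ?y S" by (simp add: eq)
    then show ?thesis unfolding cw_diff
      by (intro van(2)) (use S TI in_I in auto)
  qed
  have ne: "w (S, i) = w' (S, i)" if "S \<in> I" "S \<noteq> T" "i < t" for S i
    using eq_if_cw_cong[of \<sigma> j w w' S i] x y dvd that by (auto simp: eq)
  have "w (T, 0) = w' (T, 0)"
  proof (rule eq_if_dvd_diff)
    show "w (T, 0) < m" "w' (T, 0) < m" using w weights_lt TI t by auto
    have fin: "finite ((`) \<sigma> ` H)"
      using H finite_subset finite_imp_finite_nsets[of "{1..k}"] by blast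
    have "(\<Sum>S\<in>(`) \<sigma> ` H - {T}. w (S, 0)) = (\<Sum>S\<in>(`) \<sigma> ` H - {T}. w' (S, 0))"
      using ne copy_in_I(1)[OF per(1)] t by (intro sum.cong) auto
    moreover have "m dvd w (T, 0) + (\<Sum>S\<in>(`) \<sigma> ` H - {T}. w (S, 0))"
      "m dvd w' (T, 0) + (\<Sum>S\<in>(`) \<sigma> ` H - {T}. w' (S, 0))"
      using w sum.remove[OF fin T(1), of "\<lambda>S. w (S, 0)"] sum.remove[OF fin T(1), of "\<lambda>S. w' (S, 0)"]
      by (auto simp: weights_def eq)
    ultimately have "int m dvd int (w (T, 0) + (\<Sum>S\<in>(`) \<sigma> ` H - {T}. w (S, 0)))
        - int (w' (T, 0) + (\<Sum>S\<in>(`) \<sigma> ` H - {T}. w (S, 0)))"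
      by (intro dvd_diff) (auto simp only: int_dvd_int_iff)
    then show "int m dvd int (w (T, 0)) - int (w' (T, 0))" by simp
  qed
  then have "lead ?x T = lead ?y T" using TI by (simp add: eq)
  then have "[:int m:] dvd cw ?x T - cw ?y T"
    unfolding cw_diff by (intro van(2)) (use TI in_I in auto)
  then have "w (S, i) = w' (S, i)" if "S \<in> I" "i < t" for S i
    using eq_if_cw_cong[of \<sigma> j w w' T i] ne[of S i] x y that TI by (cases "S = T") (auto simp: eq)
  then have "w = w'"
    using w by (intro PiE_ext[of w "I \<times> {..<t}" "\<lambda>_. {..<m}" w']) (auto simp: weights_def eq)
  then show ?thesis by (simp add: eq)
qed

lemma point_eqD:
  assumes "point x i = point y i'"
  shows "fst x i = fst y i'" "S \<in> I \<Longrightarrow> int m dvd poly (cw x S - cw y S) (int (fst x i))"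
proof -
  show 1: "fst x i = fst y i'" using assms by (simp add: point_def)
  assume S: "S \<in> I"
  have "snd (point x i) S = snd (point y i') S" using assms by simp
  then have "poly (cw x S) (int (fst x i)) mod int m = poly (cw y S) (int (fst y i')) mod int m"
    using S by (simp add: point_def)
  then show "int m dvd poly (cw x S - cw y S) (int (fst x i))"
    using S 1 by (simp add: mod_eq_dvd_iff)
qed

lemma common_points:
  assumes "D \<subseteq> point x ` {1..k} \<inter> point y ` {1..k}"
  shows "fst ` D \<subseteq> fst x ` {1..k}" "fst ` D \<subseteq> fst y ` {1..k}"
    "v \<in> fst ` D \<Longrightarrow> S \<in> I \<Longrightarrow> int m dvd poly (cw x S - cw y S) (int v)"
proof -
  show "fst ` D \<subseteq> fst x ` {1..k}" "fst ` D \<subseteq> fst y ` {1..k}"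
    using assms by (force simp: point_def)+
  assume v: "v \<in> fst ` D" and S: "S \<in> I"
  then obtain i i' where i: "point x i = point y i'" "v = fst (point x i)" using assms by blast
  then have "v = fst x i" by (simp add: point_def)
  then show "int m dvd poly (cw x S - cw y S) (int v)" using point_eqD(2)[OF i(1) S] by simp
qed

lemma inj_on_fst_point: "inj_on fst (point x ` A)"
  by (auto simp: inj_on_def point_def)

lemma inj_on_point: "x \<in> X \<Longrightarrow> inj_on (point x) A"
  by (auto simp: inj_on_def point_def X_def permutes_inj[THEN inj_eq])

lemma point_in: "x \<in> X \<Longrightarrow> i \<in> {1..N} \<Longrightarrow> point x i \<in> {1..N} \<times> (I \<rightarrow>\<^sub>E {0..<int m})"
  using m permutes_in_image by (fastforce simp: point_def X_def)

text \<open>A copy meets the fibre over a first coordinate at most once, so common points project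
  injectively.\<close>

lemma card_point_Int:
  assumes x: "x \<in> X" and y: "y \<in> X" and "x \<noteq> y"
  shows "card (point x ` {1..k} \<inter> point y ` {1..k}) \<le> t"
proof (rule ccontr)
  define D where "D = point x ` {1..k} \<inter> point y ` {1..k}"
  assume "\<not> card (point x ` {1..k} \<inter> point y ` {1..k}) \<le> t"
  moreover have "card (fst ` D) = card D"
    using inj_on_subset[OF inj_on_fst_point[of x "{1..k}"]] by (intro card_image) (auto simp: D_def)
  ultimately have "t < card (fst ` D)" by (simp add: D_def)
  moreover have "fst ` D \<subseteq> {1..N}"
    using point_in[OF x] kN by (fastforce simp: D_def)
  ultimately have "x = y"
    using common_points[of D x y] by (intro eq_if_agree_Suc[OF x y, of "fst ` D"]) (auto simp: D_def)
  then show False using assms by simp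
qed

lemma point_copy_not_subset:
  assumes x: "x \<in> X" and y: "y \<in> X" and "x \<noteq> y" and S: "S \<in> H"
  shows "\<not> point x ` S \<subseteq> point y ` {1..k}"
proof
  assume sub: "point x ` S \<subseteq> point y ` {1..k}"
  obtain \<sigma> j w where x': "x = (\<sigma>, j, w)" by (cases x)
  obtain \<sigma>' j' w' where y': "y = (\<sigma>', j', w')" by (cases y)
  have "S \<subseteq> {1..k}" using S H by (auto simp: nsets_def)
  then have D: "point x ` S \<subseteq> point x ` {1..k} \<inter> point y ` {1..k}" using sub by blast
  have im: "fst ` point x ` S = \<sigma> ` S" by (simp add: image_image point_def x')
  have "x = y"
    unfolding x' y'
    using common_points[OF D, unfolded im] S x y unfolding x' y' fst_conv
    by (intro eq_if_agree_on_copy[of _ _ _ _ _ _ "\<sigma> ` S"]) auto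
  then show False using assms by simp
qed

end

section \<open>Counting and choice of parameters\<close>

text \<open>The value at \<open>p\<close> can be solved for from the others, so a single linear
  condition costs one factor \<open>m\<close>.\<close>

lemma card_zero_sum_functions:
  fixes m :: nat
  assumes "finite A" "J \<subseteq> A" "p \<in> J" "0 < m"
  shows "m ^ (card A - 1) \<le> card {w \<in> A \<rightarrow>\<^sub>E {..<m}. m dvd sum w J}"
proof -
  \<comment> \<open>The outer \<open>mod\<close> turns the value \<open>m\<close>, which occurs when
    the other values sum to a multiple of \<open>m\<close>, into \<open>0\<close>.\<close>
  define f where "f w = w(p := (m - sum w (J - {p}) mod m) mod m)" for w :: "'a \<Rightarrow> nat"
  have p: "p \<in> A" "finite J" using assms finite_subset by auto
  have "card ((A - {p}) \<rightarrow>\<^sub>E {..<m}) \<le> card {w \<in> A \<rightarrow>\<^sub>E {..<m}. m dvd sum w J}"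
  proof (rule card_inj_on_le[of f])
    show "inj_on f ((A - {p}) \<rightarrow>\<^sub>E {..<m})"
    proof (rule inj_onI)
      fix u v assume uv: "u \<in> (A - {p}) \<rightarrow>\<^sub>E {..<m}" "v \<in> (A - {p}) \<rightarrow>\<^sub>E {..<m}" "f u = f v"
      show "u = v"
      proof (rule PiE_ext[OF uv(1,2)])
        fix x assume "x \<in> A - {p}"
        then show "u x = v x" using fun_cong[OF uv(3), of x] by (simp add: f_def)
      qed
    qed
    show "f ` ((A - {p}) \<rightarrow>\<^sub>E {..<m}) \<subseteq> {w \<in> A \<rightarrow>\<^sub>E {..<m}. m dvd sum w J}"
    proof (rule image_subsetI)
      fix w assume w: "w \<in> (A - {p}) \<rightarrow>\<^sub>E {..<m}"
      define s where "s = sum w (J - {p})"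
      have "f w \<in> A \<rightarrow>\<^sub>E {..<m}"
        using assms(4) p w by (auto simp: f_def PiE_iff extensional_def)
      moreover have "sum (f w) J = f w p + sum (f w) (J - {p})"
        using p assms by (intro sum.remove) auto
      moreover have "sum (f w) (J - {p}) = s"
        unfolding s_def by (intro sum.cong) (auto simp: f_def)
      moreover have "m dvd (m - s mod m) mod m + s"
      proof -
        have "((m - s mod m) mod m + s) mod m = ((m - s mod m) + s mod m) mod m"
          by (simp only: mod_add_left_eq mod_add_right_eq)
        also have "(m - s mod m) + s mod m = m" using assms(4) by simp
        finally show ?thesis by (simp only: mod_self mod_0_imp_dvd)
      qed
      ultimately show "f w \<in> {w \<in> A \<rightarrow>\<^sub>E {..<m}. m dvd sum w J}" by (simp add: f_def s_def)
    qed
    show "finite {w \<in> A \<rightarrow>\<^sub>E {..<m}. m dvd sum w J}" using assms by (simp add: finite_PiE)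
  qed
  moreover have "card ((A - {p}) \<rightarrow>\<^sub>E {..<m}) = m ^ (card A - 1)"
    using assms p by (simp add: card_PiE)
  ultimately show ?thesis by simp
qed

section \<open>Number of copies and relabelling of the vertices\<close>

context coded_packing
begin

lemma card_weights:
  assumes "\<sigma> permutes {1..N}"
  shows "m ^ (card I * t - 1) \<le> card (weights \<sigma>)" "finite (weights \<sigma>)"
proof -
  define J where "J = (\<lambda>S. (S, 0 :: nat)) ` (`) \<sigma> ` H"
  obtain S0 where "S0 \<in> (`) \<sigma> ` H" using H by auto
  then have "(S0, 0) \<in> J" by (auto simp: J_def)
  moreover have "J \<subseteq> I \<times> {..<t}" using copy_in_I(1)[OF assms] t by (auto simp: J_def)
  moreover have "finite (I \<times> {..<t})" using finite_I by simp
  ultimately have "m ^ (card (I \<times> {..<t}) - 1) \<le> card {w \<in> (I \<times> {..<t}) \<rightarrow>\<^sub>E {..<m}. m dvd sum w J}"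
    using m by (intro card_zero_sum_functions)
  moreover have "sum w J = (\<Sum>S\<in>(`) \<sigma> ` H. w (S, 0))" for w :: "nat set \<times> nat \<Rightarrow> nat"
    unfolding J_def by (subst sum.reindex) (auto simp: inj_on_def)
  ultimately show "m ^ (card I * t - 1) \<le> card (weights \<sigma>)"
    by (simp add: weights_def card_cartesian_product)
  show "finite (weights \<sigma>)" unfolding weights_def
    using finite_I by (intro finite_subset[OF _ finite_PiE[of "I \<times> {..<t}" "\<lambda>_. {..<m}"]]) auto
qed

lemma card_X: "fact N * \<mu> * m ^ (card I * t - 1) \<le> card X"
proof -
  have fin: "finite {\<sigma>. \<sigma> permutes {1..N}}" by (simp add: finite_permutations)
  have "fact N * \<mu> * m ^ (card I * t - 1) = (\<Sum>\<sigma>\<in>{\<sigma>. \<sigma> permutes {1..N}}. \<mu> * m ^ (card I * t - 1))"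
    by (simp add: card_permutations)
  also have "\<dots> \<le> (\<Sum>\<sigma>\<in>{\<sigma>. \<sigma> permutes {1..N}}. card ({..<\<mu>} \<times> weights \<sigma>))"
    using card_weights(1) by (intro sum_mono) (auto simp: card_cartesian_product)
  also have "\<dots> = card X"
    unfolding X_def using fin card_weights(2) by (intro card_SigmaI[symmetric]) auto
  finally show ?thesis .
qed

end

lemma (in coded_packing) induced_packing_exists:
  assumes "N * m ^ card I \<le> n"
  shows "\<exists>P. induced_packing k t H n X P"
proof -
  define G where "G = {1..N} \<times> (I \<rightarrow>\<^sub>E {0..<int m})"
  have "finite G" using finite_I by (auto simp: G_def finite_PiE)
  moreover have "card G \<le> card {1..n}"
    using assms finite_I by (simp add: G_def card_cartesian_product card_PiE)
  ultimately obtain enc where enc: "enc ` G \<subseteq> {1..n}" "inj_on enc G"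
    using card_le_inj[of G "{1..n}"] by auto
  define P where "P x i = enc (point x i)" for x i
  have sub: "point x ` {1..k} \<subseteq> G" if "x \<in> X" for x
    using point_in[OF that] kN by (force simp: G_def)
  have P_im: "P x ` S = enc ` point x ` S" for x S by (auto simp: P_def image_image)
  have 1: "inj_on (P x) {1..k}" if "x \<in> X" for x
    using comp_inj_on[OF inj_on_point[OF that] inj_on_subset[OF enc(2) sub[OF that]]]
    by (simp add: P_def[abs_def] comp_def)
  have 2: "card (P x ` {1..k} \<inter> P y ` {1..k}) \<le> t" if "x \<in> X" "y \<in> X" "x \<noteq> y" for x y
  proof -
    have "P x ` {1..k} \<inter> P y ` {1..k} = enc ` (point x ` {1..k} \<inter> point y ` {1..k})"
      unfolding P_im using inj_on_image_Int[OF enc(2) sub sub] that by simp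
    then show ?thesis
      using card_point_Int[OF that] card_image_le[of "point x ` {1..k} \<inter> point y ` {1..k}" enc] by simp
  qed
  have 3: "\<not> P x ` S \<subseteq> P y ` {1..k}" if xy: "x \<in> X" "y \<in> X" "x \<noteq> y" and S: "S \<in> H" for x y S
  proof
    assume a: "P x ` S \<subseteq> P y ` {1..k}"
    have "S \<subseteq> {1..k}" using S H by (auto simp: nsets_def)
    then have "point x ` S \<subseteq> G" using sub[OF xy(1)] by blast
    then have "point x ` S \<subseteq> point y ` {1..k}"
      using a sub[OF xy(2)] inj_on_image_mem_iff[OF enc(2)] unfolding P_im by blast
    then show False using point_copy_not_subset[OF xy S] by simp
  qed
  have 4: "P x ` {1..k} \<subseteq> {1..n}" if "x \<in> X" for x
    unfolding P_im using sub[OF that] enc(1) by blast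
  show ?thesis unfolding induced_packing_def using 1 2 3 4 by blast
qed

section \<open>Regularity of the family of all copies\<close>

lemma permutes_image_exists:
  assumes "finite A" "S \<subseteq> A" "T \<subseteq> A" "card S = card T"
  shows "\<exists>\<pi>. \<pi> permutes A \<and> \<pi> ` S = T"
proof -
  have fin: "finite S" "finite T" using assms finite_subset by auto
  obtain f where f: "bij_betw f S T" using assms fin by (metis finite_same_card_bij)
  have "card (A - S) = card (A - T)" using assms fin by (simp add: card_Diff_subset)
  then obtain g where g: "bij_betw g (A - S) (A - T)" using assms by (metis finite_same_card_bij finite_Diff)
  define \<pi> where "\<pi> x = (if x \<in> A then if x \<in> S then f x else g x else x)" for x
  have fS: "bij_betw \<pi> S T" using f assms by (subst bij_betw_cong[of S \<pi> f]) (auto simp: \<pi>_def)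
  have gS: "bij_betw \<pi> (A - S) (A - T)" using g by (subst bij_betw_cong[of "A - S" \<pi> g]) (auto simp: \<pi>_def)
  have "bij_betw \<pi> (S \<union> (A - S)) (T \<union> (A - T))" by (intro bij_betw_combine fS gS) auto
  then have "bij_betw \<pi> A A" using assms by (simp add: Un_absorb1)
  then have "\<pi> permutes A" by (rule bij_imp_permutes) (auto simp: \<pi>_def)
  then show ?thesis using fS by (auto simp: bij_betw_def)
qed

lemma card_permutes_image_le:
  assumes "finite A" "T \<subseteq> A" "T' \<subseteq> A" "card T = card T'"
  shows "card {\<sigma>. \<sigma> permutes A \<and> \<sigma> ` S = T} \<le> card {\<sigma>. \<sigma> permutes A \<and> \<sigma> ` S = T'}"
proof -
  obtain \<pi> where \<pi>: "\<pi> permutes A" "\<pi> ` T = T'" using permutes_image_exists[OF assms] by blast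
  show ?thesis
  proof (rule card_inj_on_le[of "\<lambda>\<sigma>. \<pi> \<circ> \<sigma>"])
    show "inj_on ((\<circ>) \<pi>) {\<sigma>. \<sigma> permutes A \<and> \<sigma> ` S = T}"
      by (rule inj_on_subset[OF fun.inj_map[OF permutes_inj[OF \<pi>(1)]]]) simp
    show "(\<circ>) \<pi> ` {\<sigma>. \<sigma> permutes A \<and> \<sigma> ` S = T} \<subseteq> {\<sigma>. \<sigma> permutes A \<and> \<sigma> ` S = T'}"
      using \<pi> by (auto simp: image_comp[symmetric] intro: permutes_compose)
    show "finite {\<sigma>. \<sigma> permutes A \<and> \<sigma> ` S = T'}"
      using finite_permutations[OF assms(1)] by (rule rev_finite_subset) auto
  qed
qed

text \<open>Composing with permutations shows that all targets \<open>T\<close> are hit equally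
  often, and together they account for all permutations.\<close>

lemma card_permutes_image:
  assumes A: "finite A" "S \<in> [A]\<^bsup>t\<^esup>" "T \<in> [A]\<^bsup>t\<^esup>"
  shows "card {\<sigma>. \<sigma> permutes A \<and> \<sigma> ` S = T} * (card A choose t) = fact (card A)"
proof -
  define c where "c T = card {\<sigma>. \<sigma> permutes A \<and> \<sigma> ` S = T}" for T
  have "c T' = c T" if "T' \<in> [A]\<^bsup>t\<^esup>" for T'
  proof -
    have T: "T \<subseteq> A" "T' \<subseteq> A" "card T = card T'" using A that by (auto simp: nsets_def)
    show ?thesis unfolding c_def
      by (rule antisym[OF card_permutes_image_le[OF A(1) T(2,1) T(3)[symmetric]] card_permutes_image_le[OF A(1) T]])
  qed
  then have "(\<Sum>T'\<in>[A]\<^bsup>t\<^esup>. c T') = (\<Sum>T'\<in>[A]\<^bsup>t\<^esup>. c T)" by (rule sum.cong[OF refl])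
  then have "c T * (card A choose t) = (\<Sum>T'\<in>[A]\<^bsup>t\<^esup>. c T')"
    by (simp add: card_nsets mult.commute)
  also have "\<dots> = (\<Sum>T'\<in>[A]\<^bsup>t\<^esup>. \<Sum>\<sigma>\<in>{\<sigma>\<in>{\<sigma>. \<sigma> permutes A}. \<sigma> ` S = T'}. 1)"
    by (simp add: c_def)
  also have "\<dots> = (\<Sum>\<sigma>\<in>{\<sigma>. \<sigma> permutes A}. 1)"
  proof (rule sum.group)
    show "(\<lambda>\<sigma>. \<sigma> ` S) ` {\<sigma>. \<sigma> permutes A} \<subseteq> [A]\<^bsup>t\<^esup>"
    proof (rule image_subsetI)
      fix \<sigma> assume "\<sigma> \<in> {\<sigma>. \<sigma> permutes A}"
      then have \<sigma>: "\<sigma> permutes A" by simp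
      then show "\<sigma> ` S \<in> [A]\<^bsup>t\<^esup>"
        using A(2) permutes_inj_on[OF \<sigma>, of S] permutes_image[OF \<sigma>]
        by (auto simp: nsets_def card_image)
    qed
  qed (use A in \<open>auto simp: finite_permutations finite_imp_finite_nsets\<close>)
  also have "\<dots> = fact (card A)" using card_permutations[OF refl A(1)] by simp
  finally show ?thesis by (simp add: c_def)
qed

text \<open>A multiple of the product of \<open>E\<close>, plus one, is coprime to each member; so a
  whole arithmetic progression of moduli is admissible.\<close>

lemma coprime_to_all_exists:
  fixes E :: "int set"
  assumes "finite E" "0 \<notin> E"
  shows "\<exists>K>0. \<forall>i. \<forall>x\<in>E. coprime x (int (K * i + 1))"
proof (intro exI[of _ "nat \<bar>\<Prod>E\<bar>"] conjI allI ballI)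
  have "\<Prod>E \<noteq> 0" using assms by simp
  then show "nat \<bar>\<Prod>E\<bar> > 0" by simp
  fix i x assume "x \<in> E"
  then have "x dvd \<Prod>E" using assms dvd_prodI[of E x "\<lambda>x. x"] by simp
  then have "x dvd int (nat \<bar>\<Prod>E\<bar> * i)" by simp
  then show "coprime x (int (nat \<bar>\<Prod>E\<bar> * i + 1))"
    by (metis coprime_add_one_right coprime_divisors dvd_refl of_nat_1 of_nat_add)
qed

text \<open>Distinct root sets give distinct polynomials, and each pair agrees at finitely many
  integers only.\<close>

lemma separating_point_exists:
  assumes "finite I" "\<And>S. S \<in> I \<Longrightarrow> finite S"
  shows "\<exists>z. \<forall>S\<in>I. \<forall>T\<in>I. S \<noteq> T \<longrightarrow> poly (root_poly S) z \<noteq> poly (root_poly T) z"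
proof -
  define bad where "bad = (\<Union>(S, T)\<in>{(S, T). S \<in> I \<and> T \<in> I \<and> S \<noteq> T}. {z. poly (root_poly S - root_poly T) z = 0})"
  have "finite {(S, T). S \<in> I \<and> T \<in> I \<and> S \<noteq> T}"
    by (rule finite_subset[of _ "I \<times> I"]) (use assms in auto)
  moreover have "finite {z. poly (root_poly S - root_poly T) z = 0}" if "S \<in> I" "T \<in> I" "S \<noteq> T" for S T
  proof (rule poly_roots_finite)
    have "S = T" if "root_poly S = root_poly T"
      using poly_root_poly_eq_0_iff assms(2) \<open>S \<in> I\<close> \<open>T \<in> I\<close> that by (metis subsetI subset_antisym)
    then show "root_poly S - root_poly T \<noteq> 0" using that by auto
  qed
  ultimately have "finite bad" unfolding bad_def by (intro finite_UN_I) auto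
  then obtain z where "z \<notin> bad" using ex_new_if_finite infinite_UNIV_int by blast
  then show ?thesis by (intro exI[of _ z]) (auto simp: bad_def)
qed

text \<open>\<open>D\<close> bounds the number of permutations for which a given t-set is an edge of
  the copy, and \<open>R\<close> is the number of coordinates. With \<open>(m - 1) div D\<close>
  copies for each permutation, the labels of all copies through a t-set still fit.\<close>

lemma induced_packing_family:
  assumes t: "0 < t" "t \<le> k" "k \<le> N" and H: "H \<subseteq> [{1..k}]\<^bsup>t\<^esup>" "H \<noteq> {}"
  shows "\<exists>K D R. 0 < K \<and> 0 < D \<and> 0 < R \<and> D * (N choose t) = card H * fact N \<and>
    (\<forall>i n. let m = K * i + 1 in fact N \<le> m \<longrightarrow> N * m ^ R \<le> n \<longrightarrow>
      (\<exists>X P. induced_packing k t H n (X :: copy_code set) P \<and>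
        fact N * ((m - 1) div D) * m ^ (R * t - 1) \<le> card X))"
proof -
  define I0 where "I0 = [{0..N}]\<^bsup>t\<^esup>"
  have finI: "finite I0" "\<And>S. S \<in> I0 \<Longrightarrow> finite S" by (auto simp: I0_def finite_imp_finite_nsets nsets_def)
  obtain z where z: "\<forall>S\<in>I0. \<forall>T\<in>I0. S \<noteq> T \<longrightarrow> poly (root_poly S) z \<noteq> poly (root_poly T) z"
    using separating_point_exists[of I0] finI by blast
  define E where "E = (\<lambda>(u, v). int u - int v) ` ({..N} \<times> {..N}) \<union>
    (\<lambda>(S, T). poly (root_poly S) z - poly (root_poly T) z) ` (I0 \<times> I0) - {0}"
  have "finite E" "0 \<notin> E" using finI by (auto simp: E_def)
  then obtain K where K: "K > 0" "\<And>i x. x \<in> E \<Longrightarrow> coprime x (int (K * i + 1))"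
    using coprime_to_all_exists by meson
  define D where "D = card H * card {\<sigma>. \<sigma> permutes {1..N} \<and> \<sigma> ` {1..t} = {1..t}}"
  have finH: "finite H" using H finite_subset finite_imp_finite_nsets by blast
  have t1: "{1..t} \<in> [{1..N}]\<^bsup>t\<^esup>" using t by (auto simp: nsets_def)
  have Nt: "0 < N choose t" using t by simp
  have D: "D * (N choose t) = card H * fact N"
    unfolding D_def mult.assoc using card_permutes_image[OF _ t1 t1] by simp
  then have D0: "0 < D" using finH H(2) by (cases D) auto
  have deg: "card {\<sigma>. \<sigma> permutes {1..N} \<and> S \<in> (`) \<sigma> ` H} \<le> D" for S
  proof (cases "S \<in> [{1..N}]\<^bsup>t\<^esup>")
    case True
    have HN: "T \<in> [{1..N}]\<^bsup>t\<^esup>" if "T \<in> H" for T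
      using that H(1) t nsets_mono[of "{1..k}" "{1..N}" t] by auto
    have "card {\<sigma>. \<sigma> permutes {1..N} \<and> S \<in> (`) \<sigma> ` H} =
        card (\<Union>T\<in>H. {\<sigma>. \<sigma> permutes {1..N} \<and> \<sigma> ` T = S})"
      by (rule arg_cong[of _ _ card]) auto
    also have "\<dots> \<le> (\<Sum>T\<in>H. card {\<sigma>. \<sigma> permutes {1..N} \<and> \<sigma> ` T = S})"
      using finH by (rule card_UN_le)
    also have "\<dots> = (\<Sum>T\<in>H. card {\<sigma>. \<sigma> permutes {1..N} \<and> \<sigma> ` {1..t} = {1..t}})"
    proof (rule sum.cong)
      fix T assume "T \<in> H"
      then have "card {\<sigma>. \<sigma> permutes {1..N} \<and> \<sigma> ` T = S} * (N choose t) =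
          card {\<sigma>. \<sigma> permutes {1..N} \<and> \<sigma> ` {1..t} = {1..t}} * (N choose t)"
        using card_permutes_image[OF _ HN True] card_permutes_image[OF _ t1 t1] by simp
      then show "card {\<sigma>. \<sigma> permutes {1..N} \<and> \<sigma> ` T = S} =
          card {\<sigma>. \<sigma> permutes {1..N} \<and> \<sigma> ` {1..t} = {1..t}}" using Nt by simp
    qed simp
    finally show ?thesis by (simp add: D_def)
  next
    case False
    have "S \<in> [{1..N}]\<^bsup>t\<^esup>" if \<sigma>: "\<sigma> permutes {1..N}" and S: "S \<in> (`) \<sigma> ` H" for \<sigma>
    proof -
      obtain T where T: "T \<in> H" "S = \<sigma> ` T" using S by auto
      then have "T \<in> [{1..N}]\<^bsup>t\<^esup>" using H(1) t nsets_mono[of "{1..k}" "{1..N}" t] by auto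
      then show ?thesis using T(2) permutes_inj_on[OF \<sigma>, of T] permutes_image[OF \<sigma>]
        by (auto simp: nsets_def card_image)
    qed
    then have "{\<sigma>. \<sigma> permutes {1..N} \<and> S \<in> (`) \<sigma> ` H} = {}" using False by blast
    then show ?thesis by (simp only: card.empty)
  qed
  have "\<exists>X P. induced_packing k t H n (X :: copy_code set) P \<and>
        fact N * ((m - 1) div D) * m ^ (card I0 * t - 1) \<le> card X"
    if m: "m = K * i + 1" "fact N \<le> m" and n: "N * m ^ card I0 \<le> n" for i m n
  proof -
    define \<mu> where "\<mu> = (m - 1) div D"
    have finp: "finite {\<sigma>. \<sigma> permutes {1..N}}" by (simp add: finite_permutations)
    have "card {\<sigma>. \<sigma> permutes {1..N}} \<le> card {..<m}" using m by (simp add: card_permutations)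
    then obtain idn where idn: "idn ` {\<sigma>. \<sigma> permutes {1..N}} \<subseteq> {..<m}" "inj_on idn {\<sigma>. \<sigma> permutes {1..N}}"
      using card_le_inj[OF finp, of "{..<m}"] by auto
    have "\<exists>f. f ` ({\<sigma>. \<sigma> permutes {1..N} \<and> S \<in> (`) \<sigma> ` H} \<times> {..<\<mu>}) \<subseteq> {1..<m} \<and>
        inj_on f ({\<sigma>. \<sigma> permutes {1..N} \<and> S \<in> (`) \<sigma> ` H} \<times> {..<\<mu>})" for S
    proof (rule card_le_inj)
      show "finite ({\<sigma>. \<sigma> permutes {1..N} \<and> S \<in> (`) \<sigma> ` H} \<times> {..<\<mu>})"
        by (intro finite_cartesian_product finite_subset[OF _ finp]) auto
      have "card ({\<sigma>. \<sigma> permutes {1..N} \<and> S \<in> (`) \<sigma> ` H} \<times> {..<\<mu>}) \<le> D * \<mu>"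
        using deg by (simp add: card_cartesian_product)
      \<comment> \<open>The label \<open>0\<close> is reserved for t-sets inside a copy that are not
        its edges.\<close>
      also have "\<dots> \<le> m - 1" by (simp add: \<mu>_def)
      finally show "card ({\<sigma>. \<sigma> permutes {1..N} \<and> S \<in> (`) \<sigma> ` H} \<times> {..<\<mu>}) \<le> card {1..<m}" by simp
    qed simp
    from choice[OF allI[OF this]]
    obtain \<beta> where \<beta>: "\<forall>S. \<beta> S ` ({\<sigma>. \<sigma> permutes {1..N} \<and> S \<in> (`) \<sigma> ` H} \<times> {..<\<mu>}) \<subseteq> {1..<m} \<and>
        inj_on (\<beta> S) ({\<sigma>. \<sigma> permutes {1..N} \<and> S \<in> (`) \<sigma> ` H} \<times> {..<\<mu>})"
      by (rule exE)
    interpret coded_packing N k t m \<mu> z H idn \<beta>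
    proof
      show "0 < t" "k \<le> N" "t \<le> N" "0 < m" "H \<subseteq> [{1..k}]\<^bsup>t\<^esup>" "H \<noteq> {}" using t m H by auto
      show "coprime (int u - int v) (int m)" if "u \<le> N" "v \<le> N" "u \<noteq> v" for u v
        unfolding m(1) using that by (intro K(2)) (auto simp: E_def)
      show "coprime (poly (root_poly S) z - poly (root_poly T) z) (int m)"
        if "S \<in> [{0..N}]\<^bsup>t\<^esup>" "T \<in> [{0..N}]\<^bsup>t\<^esup>" "S \<noteq> T" for S T
        unfolding m(1) using that z by (intro K(2)) (auto simp: E_def I0_def)
      show "inj_on idn {\<sigma>. \<sigma> permutes {1..N}}" by (rule idn(2))
      show "idn \<sigma> < m" if "\<sigma> permutes {1..N}" for \<sigma> using that idn(1) by auto
      show "inj_on (\<beta> S) ({\<sigma>. \<sigma> permutes {1..N} \<and> S \<in> (`) \<sigma> ` H} \<times> {..<\<mu>})" for S using \<beta> by simp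
      show "\<beta> S (\<sigma>, j) \<in> {1..<m}" if "\<sigma> permutes {1..N}" "S \<in> (`) \<sigma> ` H" "j < \<mu>" for S \<sigma> j
        by (rule subsetD[OF conjunct1[OF spec[OF \<beta>]] imageI]) (use that in simp)
    qed
    have "I = I0" by (simp add: I_def I0_def)
    then show ?thesis using induced_packing_exists[of n] n card_X by (metis \<mu>_def)
  qed
  moreover have "0 < card I0" using t by (simp add: I0_def card_nsets)
  ultimately show ?thesis
    using K(1) D D0 by (intro exI[of _ K] exI[of _ D] exI[of _ "card I0"]) (auto simp: Let_def)
qed

section \<open>Asymptotics\<close>

lemma binomial_times_fact_eq_prod:
  "real (n choose t) * fact t = (\<Prod>i<t. real n - real i)"
  by (simp add: binomial_gbinomial gbinomial_prod_rev atLeast0LessThan)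

lemma binomial_asymptotic:
  "(\<lambda>n. real (n choose t) * fact t / real n ^ t) \<longlonglongrightarrow> 1"
proof -
  have "(\<lambda>n. \<Prod>i<t. (real n - real i) / real n) \<longlonglongrightarrow> (\<Prod>i<t. 1)"
    by (intro tendsto_prod) real_asymp
  then show ?thesis by (simp add: binomial_times_fact_eq_prod prod_dividef)
qed

lemma binomial_pred_over_binomial_tendsto_0:
  assumes "0 < t"
  shows "(\<lambda>n. real (n choose (t - 1)) / real (n choose t)) \<longlonglongrightarrow> 0"
proof -
  obtain r where r: "t = Suc r" using assms by (cases t) auto
  have "(\<lambda>n. real t / (real n - real r)) \<longlonglongrightarrow> 0" by real_asymp
  moreover have "\<forall>\<^sub>F n in sequentially. real t / (real n - real r) = real (n choose (t - 1)) / real (n choose t)"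
    using eventually_ge_at_top[of t]
  proof eventually_elim
    case (elim n)
    then have pos: "0 < n choose t" by simp
    have "Suc r * (n choose Suc r) = (n - r) * (n choose r)"
      by (simp only: binomial_absorption binomial_absorb_comp)
    then have "real t * real (n choose t) = (real n - real r) * real (n choose r)"
      using elim r by (metis of_nat_diff of_nat_mult Suc_leD)
    then show ?case using pos elim r by (simp add: field_simps)
  qed
  ultimately show ?thesis by (rule Lim_transform_eventually)
qed

lemma filterlim_root_at_top:
  assumes "0 < R" "0 < N"
  shows "filterlim (\<lambda>n. root R (real n / real N)) at_top sequentially"
  unfolding filterlim_at_top_ge[where c = 1]
proof (intro allI impI)
  fix B :: real assume B: "1 \<le> B"
  have "\<forall>\<^sub>F n in sequentially. B ^ R * real N \<le> real n"
    using filterlim_real_sequentially by (auto simp: filterlim_at_top)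
  then show "\<forall>\<^sub>F n in sequentially. B \<le> root R (real n / real N)"
  proof eventually_elim
    case (elim n)
    then have "root R (B ^ R) \<le> root R (real n / real N)"
      using assms by (intro real_root_le_mono) (auto simp: field_simps)
    then show ?case using assms B by (simp add: real_root_power_cancel)
  qed
qed

text \<open>First \<open>N\<close> is fixed with density \<open>C N\<close> above
  \<open>1 / card H - e\<close>; then \<open>n\<close> grows, and \<open>m\<close> is the largest
  modulus \<open>K * i + 1\<close> with \<open>N * m ^ R \<le> n\<close>.\<close>

lemma induced_packing_asymptotic:
  assumes t: "0 < t" "t \<le> k" and H: "H \<subseteq> [{1..k}]\<^bsup>t\<^esup>" "H \<noteq> {}" and e: "0 < e"
  shows "\<forall>\<^sub>F n in sequentially.
    \<exists>(X :: copy_code set) P.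
      induced_packing k t H n X P \<and> (1 / real (card H) - e) * real (n choose t) \<le> real (card X)"
proof -
  have finH: "finite H" using H finite_subset finite_imp_finite_nsets by blast
  then have h: "0 < card H" using H by (simp add: card_gt_0_iff)
  \<comment> \<open>Limiting density for fixed \<open>N\<close>: about
    \<open>fact N / D * m ^ (R * t)\<close> copies against \<open>(N * m ^ R) ^ t / fact t\<close>
    t-subsets, rewritten by \<open>D * (N choose t) = card H * fact N\<close>.\<close>
  define C where "C N = real (N choose t) * fact t / real N ^ t / real (card H)" for N
  have "C \<longlonglongrightarrow> 1 / real (card H)"
    unfolding C_def using h by (intro tendsto_divide binomial_asymptotic) auto
  moreover have "1 / real (card H) - e < 1 / real (card H)" using e by simp
  ultimately have "\<forall>\<^sub>F N in sequentially. 1 / real (card H) - e < C N" by (rule order_tendstoD)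
  then have "\<forall>\<^sub>F N in sequentially. 1 / real (card H) - e < C N \<and> k \<le> N"
    using eventually_ge_at_top by (rule eventually_conj)
  then obtain N where N: "1 / real (card H) - e < C N" "k \<le> N"
    by (auto simp: eventually_sequentially)
  have N0: "0 < N" using t N by simp
  obtain K D R where K: "0 < K" and D: "0 < D" and R: "0 < R"
    and DN: "D * (N choose t) = card H * fact N"
    and packing: "\<And>i n. fact N \<le> K * i + 1 \<Longrightarrow> N * (K * i + 1) ^ R \<le> n \<Longrightarrow>
      \<exists>(X :: copy_code set) P. induced_packing k t H n X P \<and>
        fact N * ((K * i + 1 - 1) div D) * (K * i + 1) ^ (R * t - 1) \<le> card X"
    using induced_packing_family[OF t N(2) H] unfolding Let_def by blast
  \<comment> \<open>The real solution of \<open>N * y ^ R = n\<close>, an upper bound for the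
    modulus.\<close>
  define y where "y n = root R (real n / real N)" for n
  have y: "filterlim y at_top sequentially"
    unfolding y_def using R N0 by (rule filterlim_root_at_top)
  \<comment> \<open>Relative loss from rounding: \<open>m\<close> is at least \<open>y - K\<close>,
    since admissible moduli are \<open>K\<close> apart, and \<open>(m - 1) div D\<close> loses up to
    \<open>D + 1\<close> more in the numerator.\<close>
  define g where "g y = (y - real (K + 1 + D)) / y * ((y - real K) / y) ^ (R * t - 1)" for y :: real
  have "(g \<longlongrightarrow> 1 * 1 ^ (R * t - 1)) at_top"
    unfolding g_def by (intro tendsto_mult tendsto_power) real_asymp+
  then have "(\<lambda>n. C N * g (y n)) \<longlonglongrightarrow> C N * 1"
    using filterlim_compose[OF _ y] by (intro tendsto_mult) auto
  then have "\<forall>\<^sub>F n in sequentially. 1 / real (card H) - e < C N * g (y n)"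
    using N(1) by (intro order_tendstoD(1)) auto
  \<comment> \<open>This makes \<open>m\<close> at least \<open>fact N\<close>, as the packing
    requires, and keeps the factors of \<open>g\<close> nonnegative.\<close>
  moreover have "\<forall>\<^sub>F n in sequentially. real (K + 1 + D + fact N) \<le> y n"
    using y by (auto simp: filterlim_at_top)
  ultimately show ?thesis
  proof eventually_elim
    case (elim n)
    define i where "i = nat \<lfloor>(y n - 1) / real K\<rfloor>"
    define m where "m = K * i + 1"
    have "real (K + 1 + D) \<le> real (K + 1 + D + fact N)" by (simp only: of_nat_le_iff)
    then have yn: "real (K + 1 + D) \<le> y n" using elim(2) by linarith
    then have "1 \<le> y n" by simp
    note yn = yn this
    have fl: "real i \<le> (y n - 1) / real K" "(y n - 1) / real K < real i + 1"
      using yn K by (auto simp: i_def)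
    have m: "real m \<le> y n" "y n - real K \<le> real m"
      using fl K by (auto simp: m_def field_simps)
    have "real (fact N) \<le> real m" using m elim(2) by (simp add: algebra_simps)
    then have "fact N \<le> m" by (simp only: of_nat_le_iff)
    moreover have "N * m ^ R \<le> n"
    proof -
      have "real m ^ R \<le> y n ^ R" using m by (intro power_mono) auto
      also have "\<dots> = real n / real N" using R by (simp add: y_def)
      finally have "real (N * m ^ R) \<le> real n" using N0 by (simp add: field_simps)
      then show ?thesis by (simp only: of_nat_le_iff)
    qed
    ultimately obtain X :: "copy_code set" and P
      where XP: "induced_packing k t H n X P" "fact N * ((m - 1) div D) * m ^ (R * t - 1) \<le> card X"
      using packing[of i n] unfolding m_def by blast
    have y0: "0 < y n" and g0: "0 \<le> g (y n)" using yn by (auto simp: g_def)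
    have yRt: "y n ^ (R * t) = (real n / real N) ^ t" using R by (simp add: y_def power_mult)
    have "R * t = Suc (R * t - 1)" using R t by simp
    then have ysplit: "y n ^ (R * t) = y n * y n ^ (R * t - 1)" by (metis power_Suc)
    have "(1 / real (card H) - e) * real (n choose t) \<le> C N * g (y n) * real (n choose t)"
      using elim(1) by (intro mult_right_mono) auto
    also have "C N = fact N / real D * fact t / real N ^ t"
    proof -
      have "real D * real (N choose t) = real (card H) * fact N"
        using DN by (metis of_nat_fact of_nat_mult)
      then have "real (N choose t) / real (card H) = fact N / real D"
        using h D by (simp add: field_simps)
      moreover have "C N = real (N choose t) / real (card H) * fact t / real N ^ t" by (simp add: C_def)
      ultimately show ?thesis by simp
    qed
    also have "fact N / real D * fact t / real N ^ t * g (y n) * real (n choose t)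
        = (fact N / real D / real N ^ t * g (y n)) * (real (n choose t) * fact t)" by simp
    also have "\<dots> \<le> (fact N / real D / real N ^ t * g (y n)) * real n ^ t"
    proof (rule mult_left_mono)
      have "real ((n choose t) * fact t) \<le> real (n ^ t)"
        using binomial_fact_pow[of n t] by (simp only: of_nat_le_iff)
      then show "real (n choose t) * fact t \<le> real n ^ t" by simp
    qed (use g0 in simp)
    also have "\<dots> = fact N / real D * (y n ^ (R * t) * g (y n))"
      unfolding yRt by (simp add: power_divide)
    also have "y n ^ (R * t) * g (y n) = (y n - real (K + 1 + D)) * (y n - real K) ^ (R * t - 1)"
      unfolding ysplit g_def using y0 by (simp add: power_divide)
    also have "fact N / real D * \<dots> = fact N * ((y n - real (K + 1 + D)) / real D) * (y n - real K) ^ (R * t - 1)"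
      by simp
    also have "\<dots> \<le> fact N * real ((m - 1) div D) * real m ^ (R * t - 1)"
    proof -
      have "(m - 1) div D * D + (m - 1) mod D = m - 1" by (rule div_mult_mod_eq)
      moreover have "(m - 1) mod D < D" using D by simp
      ultimately have "m - 1 < (m - 1) div D * D + D" by linarith
      then have "real (m - 1) \<le> real ((m - 1) div D) * real D + real D"
        by (metis less_imp_le of_nat_add of_nat_le_iff of_nat_mult)
      moreover have "real m - 1 \<le> real (m - 1)" by (simp add: m_def)
      ultimately have 1: "(y n - real (K + 1 + D)) / real D \<le> real ((m - 1) div D)"
        using m(2) D by (simp add: field_simps)
      have nonneg: "0 \<le> y n - real (K + 1 + D)" "0 \<le> y n - real K" using yn by simp_all
      have 2: "(y n - real K) ^ (R * t - 1) \<le> real m ^ (R * t - 1)"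
        using m(2) nonneg(2) by (rule power_mono)
      show ?thesis
        by (rule mult_mono[OF mult_left_mono[OF 1 fact_ge_zero] 2 _ zero_le_power[OF nonneg(2)]]) simp
    qed
    also have "\<dots> \<le> real (card X)"
    proof -
      have "real (fact N * ((m - 1) div D) * m ^ (R * t - 1)) \<le> real (card X)"
        using XP(2) by (simp only: of_nat_le_iff)
      then show ?thesis by (simp only: of_nat_mult of_nat_fact of_nat_power)
    qed
    finally show ?case using XP(1) by blast
  qed
qed

theorem theorem1p1:
  fixes c s k t l :: nat
  assumes "c \<ge> 2" and "k \<ge> 2" and "1 \<le> s" and "s \<le> c - 1"
    and "int t = \<lceil>real (s * k) / real c\<rceil>"
    and "l \<in> {1..c}" and "[l = s * k] (mod c)"
  shows "(\<lambda>n. real (max_frameproof c s n k) / real (n choose t))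
    \<longlonglongrightarrow> 1 / (real (k choose t) - real (gen_matching_number k t l (s + 1) (c - s + 1)))"
proof -
  have "t \<ge> 1" and sk: "s * k = c * (t - 1) + l"
    using ceiling_division_with_remainder[OF _ _ assms(5-7)] assms(1-3) by auto
  then have par: "1 \<le> s" "s < c" "1 \<le> t" "1 \<le> l" "l \<le> c" "s * k = c * (t - 1) + l"
    using assms by auto
  define g where "g = gen_matching_number k t l (s + 1) (c - s + 1)"
  define h where "h = (k choose t) - g"
  have less: "g < k choose t" unfolding g_def by (rule gen_matching_number_less[OF par])
  then have hg: "h + g = k choose t" and h: "0 < h" by (auto simp: h_def)
  have tk: "t \<le> k" using less by (metis binomial_eq_0 not_le not_less0)
  define a where "a n = real (max_frameproof c s n k) / real (n choose t)" for n
  \<comment> \<open>For \<open>n < t\<close> the quotient \<open>a n\<close> is \<open>0\<close> by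
    the convention for division by zero.\<close>
  have pos: "\<forall>\<^sub>F n in sequentially. 0 < n choose t"
    using eventually_ge_at_top[of t] by eventually_elim simp
  have "a \<longlonglongrightarrow> 1 / real h"
  proof (rule order_tendstoI)
    fix b assume "1 / real h < b"
    \<comment> \<open>The second summand pays for the edges that have an own (t-1)-subset.\<close>
    moreover have "(\<lambda>n. 1 / real h + real (n choose (t - 1)) / real (n choose t)) \<longlonglongrightarrow> 1 / real h + 0"
      using par by (intro tendsto_add tendsto_const binomial_pred_over_binomial_tendsto_0) simp
    ultimately have "\<forall>\<^sub>F n in sequentially. 1 / real h + real (n choose (t - 1)) / real (n choose t) < b"
      by (intro order_tendstoD) auto
    then show "\<forall>\<^sub>F n in sequentially. a n < b" using pos
    proof eventually_elim
      case (elim n)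
      obtain F where F: "F \<subseteq> [{1..n}]\<^bsup>k\<^esup>" "frameproof c s F" "card F = max_frameproof c s n k"
        using max_frameproof_attained by blast
      have "card F * h \<le> (n choose t) + (n choose (t - 1)) * h"
        using hg by (intro card_frameproof_le[OF par F(1,2)]) (simp add: g_def)
      then have "real (card F * h) \<le> real ((n choose t) + (n choose (t - 1)) * h)" by (simp only: of_nat_le_iff)
      then have "a n \<le> 1 / real h + real (n choose (t - 1)) / real (n choose t)"
        unfolding a_def F(3)[symmetric] using h elim(2) by (simp add: field_simps)
      then show ?case using elim(1) by simp
    qed
  next
    fix b assume b: "b < 1 / real h"
    obtain M where M: "free_family k t l (s + 1) (c - s + 1) M" "card M = g"
      using gen_matching_number_attained[OF par(4)] unfolding g_def by blast
    define H where "H = [{1..k}]\<^bsup>t\<^esup> - M"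
    have "M \<subseteq> [{1..k}]\<^bsup>t\<^esup>" using M by (simp add: free_family_def)
    then have cH: "card H = h"
      unfolding H_def h_def using M(2)
      by (subst card_Diff_subset) (auto simp: card_nsets finite_imp_finite_nsets intro: finite_subset)
    then have neH: "H \<noteq> {}" using h by auto
    \<comment> \<open>Half of the gap between \<open>b\<close> and \<open>1 / h\<close> serves as
      the error, which leaves the final inequality strict.\<close>
    have "\<forall>\<^sub>F n in sequentially.
      \<exists>(X :: copy_code set) P. induced_packing k t H n X P \<and>
        (1 / real (card H) - (1 / real h - b) / 2) * real (n choose t) \<le> real (card X)"
      using par tk neH b by (intro induced_packing_asymptotic) (auto simp: H_def)
    then show "\<forall>\<^sub>F n in sequentially. b < a n" using pos
    proof eventually_elim
      case (elim n)
      then obtain X :: "copy_code set" and P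
        where X: "induced_packing k t H n X P"
          "(1 / real h - (1 / real h - b) / 2) * real (n choose t) \<le> real (card X)"
        unfolding cH by blast
      have "b < 1 / real h - (1 / real h - b) / 2" using b by (simp add: field_simps)
      then have "b * real (n choose t) < (1 / real h - (1 / real h - b) / 2) * real (n choose t)"
        using elim(2) by (intro mult_strict_right_mono) auto
      also have "\<dots> \<le> real (max_frameproof c s n k)"
        using X(2) card_packing_le_max_frameproof[OF par M(1) tk neH[unfolded H_def] X(1)[unfolded H_def]]
        by linarith
      finally show ?case unfolding a_def using elim(2) by (simp add: field_simps)
    qed
  qed
  moreover have "real h = real (k choose t) - real g" using less by (simp add: h_def of_nat_diff)
  ultimately show ?thesis by (simp add: a_def[abs_def] g_def)
qed

end
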